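(* Assume that $\mathfrak{d}\leq\mathfrak{r}$ and that the cardinal number $\mathfrak{d}$ is regular. Then: (1) There are two sets of reals all of whose finite powers are Menger, but whose union is not Scheepers. (2) The Scheepers property is not additive; that is, there are two Scheepers sets of reals whose union is not Scheepers. (3) There are two sets of reals all of whose finite powers are Menger, but whose product space is not Menger. (4) The Scheepers property is not productive; that is, there are two Scheepers sets of reals whose product space is not Scheepers.
   Context: A set of reals is a topological space homeomorphic to a subspace of the real line with the standard topology. When the union of two sets of reals is considered, both are understood as subspaces of a common set of reals, and the union carries the subspace topology. A space $X$ is Menger if for each sequence $\mathcal{U}_1,\mathcal{U}_2,\dotsc$ of open covers of $X$ there are finite sets $\mathcal{F}_1\subseteq\mathcal{U}_1,\mathcal{F}_2\subseteq\mathcal{U}_2,\dotsc$ such that the family $\bigcup_{n}\mathcal{F}_n$ covers $X$. A space $X$ is Scheepers if for each such sequence there are finite sets $\mathcal{F}_n\subseteq\mathcal{U}_n$ such that each finite subset of $X$ is contained in $\bigcup\mathcal{F}_n$ for some $n$. $\mathbb{N}$ is the set of positive natural numbers and $[\mathbb{N}]^\infty$ is the set of infinite subsets of $\mathbb{N}$. Each $a\in[\mathbb{N}]^\infty$ is identified with its increasing enumeration, so $a(n)$ is the $n$-th smallest element of $a$. For $x,y\in[\mathbb{N}]^\infty$, $x\leq^* y$ means that $\{n: y(n)<x(n)\}$ is finite. A subset $D$ of $[\mathbb{N}]^\infty$ is dominating if for each $x\in[\mathbb{N}]^\infty$ there is $y\in D$ with $x\leq^* y$; $\mathfrak{d}$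 is the minimal cardinality of a dominating subset of $[\mathbb{N}]^\infty$. A set $r\in[\mathbb{N}]^\infty$ reaps a family $A\subseteq[\mathbb{N}]^\infty$ if for each $a\in A$ both $a\cap r$ and $a\setminus r$ are infinite; $\mathfrak{r}$ is the minimal cardinality of a family $A\subseteq[\mathbb{N}]^\infty$ that no set $r\in[\mathbb{N}]^\infty$ reaps. *)

theory Defs
  imports "HOL-Analysis.Analysis"
begin

unbundle cardinal_syntax

definition open_cover :: "'a topology \<Rightarrow> 'a set set \<Rightarrow> bool" where
  "open_cover X \<U> \<longleftrightarrow> (\<forall>U\<in>\<U>. openin X U) \<and> \<Union>\<U> = topspace X"

definition Menger :: "'a topology \<Rightarrow> bool" where
  "Menger X \<longleftrightarrow>
     (\<forall>\<U> :: nat \<Rightarrow> 'a set set. (\<forall>n. open_cover X (\<U> n)) \<longrightarrow>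
        (\<exists>\<F>. (\<forall>n. finite (\<F> n) \<and> \<F> n \<subseteq> \<U> n) \<and> topspace X \<subseteq> \<Union>(\<Union>n. \<F> n)))"

definition Scheepers :: "'a topology \<Rightarrow> bool" where
  "Scheepers X \<longleftrightarrow>
     (\<forall>\<U> :: nat \<Rightarrow> 'a set set. (\<forall>n. open_cover X (\<U> n)) \<longrightarrow>
        (\<exists>\<F>. (\<forall>n. finite (\<F> n) \<and> \<F> n \<subseteq> \<U> n) \<and>
             (\<forall>S. finite S \<and> S \<subseteq> topspace X \<longrightarrow> (\<exists>n. S \<subseteq> \<Union>(\<F> n)))))"

definition finite_power :: "'a topology \<Rightarrow> nat \<Rightarrow> (nat \<Rightarrow> 'a) topology" where
  "finite_power X n = product_topology (\<lambda>_. X) {..<n}"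

text \<open>Cardinal numbers are represented, as usual in HOL, by well-order relations of minimal
  order type; they are determined only up to order isomorphism.\<close>

definition min_card :: "'a set set \<Rightarrow> 'a rel" where
  "min_card \<A> = (SOME r. r \<in> card_of ` \<A> \<and> (\<forall>A\<in>\<A>. r \<le>o |A| ))"

lemma min_card:
  assumes "\<A> \<noteq> {}"
  shows "min_card \<A> \<in> card_of ` \<A>" and "\<And>A. A \<in> \<A> \<Longrightarrow> min_card \<A> \<le>o |A|"
proof -
  have "\<exists>r\<in>card_of ` \<A>. \<forall>r'\<in>card_of ` \<A>. r \<le>o r'"
    using assms by (intro exists_minim_Card_order) (auto simp: card_of_Card_order)
  then have "\<exists>r. r \<in> card_of ` \<A> \<and> (\<forall>A\<in>\<A>. r \<le>o |A| )"
    by blast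
  from someI_ex[OF this] show "min_card \<A> \<in> card_of ` \<A>" "\<And>A. A \<in> \<A> \<Longrightarrow> min_card \<A> \<le>o |A|"
    unfolding min_card_def by auto
qed

definition inf_sets :: "nat set set" where
  "inf_sets = {a. a \<subseteq> {1..} \<and> infinite a}"

text \<open>\<open>enumerate a\<close> lists \<open>a\<close> in increasing order starting at index 0; this shift of the
  index does not affect finiteness of the set below.\<close>

definition le_star :: "nat set \<Rightarrow> nat set \<Rightarrow> bool" (infix "\<le>\<^sup>*" 50) where
  "x \<le>\<^sup>* y \<longleftrightarrow> finite {n. enumerate y n < enumerate x n}"

definition dominating :: "nat set set \<Rightarrow> bool" where
  "dominating D \<longleftrightarrow> D \<subseteq> inf_sets \<and> (\<forall>x\<in>inf_sets. \<exists>y\<in>D. x \<le>\<^sup>* y)"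

definition reaps :: "nat set \<Rightarrow> nat set set \<Rightarrow> bool" where
  "reaps r A \<longleftrightarrow> (\<forall>a\<in>A. infinite (a \<inter> r) \<and> infinite (a - r))"

definition unreaped :: "nat set set \<Rightarrow> bool" where
  "unreaped A \<longleftrightarrow> A \<subseteq> inf_sets \<and> \<not> (\<exists>r\<in>inf_sets. reaps r A)"

definition dominating_number :: "nat set rel" ("\<dd>") where
  "\<dd> = min_card {D. dominating D}"

definition reaping_number :: "nat set rel" ("\<rr>") where
  "\<rr> = min_card {A. unreaped A}"

lemma dominating_exists: "{D. dominating D} \<noteq> {}"
proof -
  have "x \<le>\<^sup>* x" for x by (simp add: le_star_def)
  then have "dominating inf_sets" by (auto simp: dominating_def)
  then show ?thesis by blast
qed

lemma unreaped_exists: "{A. unreaped A} \<noteq> {}"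
proof -
  have "unreaped inf_sets"
    unfolding unreaped_def reaps_def by (metis Diff_cancel finite.emptyI subset_refl)
  then show ?thesis by blast
qed

end

(* A space is treated "along a filter" F on the natural numbers: from the n-th cover finitely many
   sets are selected so that every point is covered for F-almost all n. This implies the Scheepers
   property. It is preserved by products with X together with the finite sets, where X = {x_c : c < d}
   is a family of subsets of the naturals (embedded in the reals) such that, for every function g,
   all but fewer than d members of X omit the interval [m, g m) for F-almost all m, and such that
   fewer than d functions always have a common bound F-almost everywhere. Hence all finite powers
   of such an X are Menger.

   By recursion of length d one builds x_c and y_c so that, for the c-th function g of a dominating
   family, each interval [n, g n) is contained in x_c or in y_c, while the sets of starting points
   of long gaps of the x_c, and likewise of the y_c, generate filters. The open sets of those a that
   omit a point of [n, m) then show that the union of the two sets is not Scheepers and their product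
   is not Menger. At each step the gaps are placed along an interval sequence that escapes the fewer
   than d functions produced so far, and a reaping set distributes them between x_c and y_c; this
   uses d <= r. Regularity of d gives the common bounds. *)

theory Submission
  imports Defs
begin

section \<open>Sets of naturals as real numbers\<close>

text \<open>Base 3 with digits 0 and 1 leaves room between values: all positions beyond k together
  weigh at most half as much as position k. So the map is injective and the image carries the
  topology of the Cantor space.\<close>

definition ternary :: "nat set \<Rightarrow> real" where
  "ternary a = (\<Sum>n. if n \<in> a then (1/3)^n else 0)"

lemma ternary_tail:
  "summable (\<lambda>n. if n + m \<in> a then (1/3::real)^(n + m) else 0)" (is ?s)
  "(\<Sum>n. if n + m \<in> a then (1/3::real)^(n + m) else 0) \<in> {0..3/2 * (1/3)^m}" (is ?b)
proof -
  have g: "(\<lambda>n. (1/3::real)^(n + m)) sums (3/2 * (1/3)^m)"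
    using sums_mult2[OF geometric_sums[of "1/3::real"], of "(1/3)^m"] by (simp add: power_add)
  show s: ?s
    by (rule summable_comparison_test[OF _ sums_summable[OF g]]) auto
  have "(\<Sum>n. if n + m \<in> a then (1/3::real)^(n + m) else 0) \<le> (\<Sum>n. (1/3)^(n + m))"
    by (rule suminf_le[OF _ s sums_summable[OF g]]) auto
  then show ?b
    using s sums_unique[OF g] by (auto intro!: suminf_nonneg)
qed

lemma ternary_split:
  "ternary a = (\<Sum>n. if n + m \<in> a then (1/3)^(n + m) else 0) + (\<Sum>n<m. if n \<in> a then (1/3)^n else 0)"
proof -
  have "summable (\<lambda>n. if n \<in> a then (1/3::real)^n else 0)"
    by (rule ternary_tail(1)[of 0 a, unfolded add_0_right])
  then show ?thesis
    unfolding ternary_def by (rule suminf_split_initial_segment)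
qed

lemma ternary_init_cong:
  assumes "a \<inter> {..<m} = b \<inter> {..<m}"
  shows "(\<Sum>n<m. if n \<in> a then (1/3)^n else 0) = (\<Sum>n<m. if n \<in> b then (1/3::real)^n else 0)"
proof (rule sum.cong)
  fix n assume "n \<in> {..<m}"
  then have "n \<in> a \<longleftrightarrow> n \<in> b" using assms by blast
  then show "(if n \<in> a then (1/3)^n else 0) = (if n \<in> b then (1/3::real)^n else 0)" by simp
qed simp

lemma ternary_close:
  assumes "a \<inter> {..<m} = b \<inter> {..<m}"
  shows "\<bar>ternary a - ternary b\<bar> \<le> 3/2 * (1/3)^m"
  using ternary_init_cong[OF assms] ternary_split[of a m] ternary_split[of b m]
    ternary_tail(2)[of m a] ternary_tail(2)[of m b] unfolding atLeastAtMost_iff by linarith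

text \<open>At the first difference, \<open>a\<close> gains (1/3)^k, and the later digits of
  \<open>b\<close> recover at most half of that.\<close>

lemma ternary_far:
  assumes "a \<inter> {..<k} = b \<inter> {..<k}" "k \<in> a" "k \<notin> b"
  shows "ternary a - ternary b \<ge> (1/3)^k / 2"
proof -
  have "(\<Sum>n<Suc k. if n \<in> a then (1/3)^n else 0) = (\<Sum>n<Suc k. if n \<in> b then (1/3::real)^n else 0) + (1/3)^k"
    using ternary_init_cong[OF assms(1)] assms(2,3) by simp
  moreover have "3/2 * (1/3::real)^Suc k = (1/3)^k / 2" by simp
  ultimately show ?thesis
    using ternary_split[of a "Suc k"] ternary_split[of b "Suc k"]
      ternary_tail(2)[of "Suc k" a] ternary_tail(2)[of "Suc k" b]
    unfolding atLeastAtMost_iff by linarith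
qed

lemma ternary_eq_below:
  assumes "dist (ternary a) (ternary b) < (1/3)^m / 2"
  shows "a \<inter> {..<m} = b \<inter> {..<m}"
proof (rule ccontr)
  assume ne: "a \<inter> {..<m} \<noteq> b \<inter> {..<m}"
  define k where "k = (LEAST i. (i \<in> a) \<noteq> (i \<in> b))"
  obtain i where i: "i < m" "(i \<in> a) \<noteq> (i \<in> b)" using ne by blast
  have k: "(k \<in> a) \<noteq> (k \<in> b)" "k \<le> i"
    unfolding k_def using i(2) by (rule LeastI Least_le)+
  have "(i \<in> a) = (i \<in> b)" if "i < k" for i
    using not_less_Least[of i "\<lambda>i. (i \<in> a) \<noteq> (i \<in> b)"] that unfolding k_def by simp
  then have eq: "a \<inter> {..<k} = b \<inter> {..<k}" by auto
  have "\<bar>ternary a - ternary b\<bar> \<ge> (1/3)^k / 2"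
  proof (cases "k \<in> a")
    case True
    then show ?thesis using k(1) ternary_far[OF eq] by (simp add: abs_if)
  next
    case False
    then show ?thesis using k(1) ternary_far[OF eq[symmetric]] by (simp add: abs_if)
  qed
  moreover have "(1/3::real)^m \<le> (1/3)^k" using k i by (intro power_decreasing) auto
  ultimately show False using assms unfolding dist_real_def by linarith
qed

lemma inj_ternary: "inj ternary"
proof (rule injI)
  fix a b assume "ternary a = ternary b"
  then have eq: "a \<inter> {..<m} = b \<inter> {..<m}" for m by (intro ternary_eq_below) auto
  show "a = b"
  proof (rule set_eqI)
    show "i \<in> a \<longleftrightarrow> i \<in> b" for i using eq[of "Suc i"] by blast
  qed
qed

text \<open>Continuity of \<open>ternary\<close> in the form used for products: finitely many digits
  of \<open>a\<close> already guarantee membership in \<open>W\<close>.\<close>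

lemma ternary_nbhd:
  assumes "openin (top_of_set (ternary ` Z)) W" "ternary a \<in> W"
  obtains l where "\<And>b. b \<in> Z \<Longrightarrow> b \<inter> {..<l} = a \<inter> {..<l} \<Longrightarrow> ternary b \<in> W"
proof -
  obtain U where U: "open U" "W = ternary ` Z \<inter> U" using assms(1) by (auto simp: openin_open)
  have "ternary a \<in> U" using U(2) assms(2) by simp
  from U(1)[unfolded open_dist, rule_format, OF this]
  obtain e where e: "e > 0" "\<forall>y. dist y (ternary a) < e \<longrightarrow> y \<in> U"
    by (elim exE conjE)
  have "\<exists>l. (1/3::real)^l < 2/3 * e"
    using e(1) by (intro real_arch_pow_inv) auto
  then obtain l where "(1/3::real)^l < 2/3 * e" ..
  then have "3/2 * (1/3)^l < e" by simp
  then have "ternary b \<in> W" if "b \<in> Z" "b \<inter> {..<l} = a \<inter> {..<l}" for b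
  proof -
    have "dist (ternary b) (ternary a) < e"
      using ternary_close[OF that(2)] \<open>3/2 * (1/3)^l < e\<close> unfolding dist_real_def by linarith
    then show ?thesis using e(2) U(2) that(1) by simp
  qed
  then show thesis by (rule that)
qed

text \<open>The hypothesis says that the digits below \<open>m\<close> decide membership in
  \<open>S\<close>. By \<open>ternary_eq_below\<close>, a ball of radius (1/3)^m / 2 around a point
  of the image meets the image only in points with the same digits below \<open>m\<close>.\<close>

lemma openin_ternary_image:
  assumes "\<And>a b. a \<in> S \<Longrightarrow> a \<inter> {..<m} = b \<inter> {..<m} \<Longrightarrow> b \<in> S"
  shows "openin (top_of_set (ternary ` Z)) (ternary ` (Z \<inter> S))"
proof -
  let ?U = "\<Union>a\<in>Z \<inter> S. ball (ternary a) ((1/3)^m / 2)"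
  have "ternary ` (Z \<inter> S) = ternary ` Z \<inter> ?U"
  proof (intro equalityI subsetI)
    fix x assume "x \<in> ternary ` (Z \<inter> S)"
    then obtain a where a: "a \<in> Z \<inter> S" "x = ternary a" by blast
    then have "x \<in> ball (ternary a) ((1/3)^m / 2)" by simp
    then show "x \<in> ternary ` Z \<inter> ?U" using a by blast
  next
    fix x assume "x \<in> ternary ` Z \<inter> ?U"
    then obtain a b where "b \<in> Z" "x = ternary b" "a \<in> S" "dist (ternary a) (ternary b) < (1/3)^m / 2"
      by auto
    then show "x \<in> ternary ` (Z \<inter> S)" using assms[OF _ ternary_eq_below] by auto
  qed
  moreover have "open ?U" by blast
  ultimately show ?thesis by (simp add: openin_open_Int)
qed

section \<open>The Menger property along a filter\<close>

text \<open>Restricting to countable increasing covers loses nothing for Lindelof spaces, and makes a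
  choice of finite subfamilies the same as a function on the natural numbers.\<close>

definition Menger_along :: "nat filter \<Rightarrow> 'a topology \<Rightarrow> bool" where
  "Menger_along F X \<longleftrightarrow>
     (\<forall>U :: nat \<Rightarrow> nat \<Rightarrow> 'a set.
        (\<forall>n k. openin X (U n k)) \<and> (\<forall>n. mono (U n)) \<and> (\<forall>n. topspace X \<subseteq> (\<Union>k. U n k)) \<longrightarrow>
        (\<exists>f. \<forall>x\<in>topspace X. eventually (\<lambda>n. x \<in> U n (f n)) F))"

lemma Menger_alongE:
  fixes U :: "nat \<Rightarrow> nat \<Rightarrow> 'a set"
  assumes "Menger_along F X" "\<And>n k. openin X (U n k)" "\<And>n. mono (U n)"
    "\<And>n. topspace X \<subseteq> (\<Union>k. U n k)"
  obtains f where "\<And>x. x \<in> topspace X \<Longrightarrow> eventually (\<lambda>n. x \<in> U n (f n)) F"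
proof -
  have "\<exists>f. \<forall>x\<in>topspace X. eventually (\<lambda>n. x \<in> U n (f n)) F"
    by (rule mp[OF assms(1)[unfolded Menger_along_def, THEN spec[where x = U]]])
      (intro conjI allI assms(2-4))
  then show thesis using that by blast
qed

text \<open>Covers of \<open>Y\<close> are pulled back along \<open>h\<close>, and the function
  found for \<open>X\<close> serves for \<open>Y\<close>.\<close>

lemma Menger_along_image:
  assumes M: "Menger_along F X" and h: "continuous_map X Y h" "h ` topspace X = topspace Y"
  shows "Menger_along F Y"
  unfolding Menger_along_def
proof safe
  fix U :: "nat \<Rightarrow> nat \<Rightarrow> 'b set"
  assume U: "\<forall>n k. openin Y (U n k)" "\<forall>n. mono (U n)" "\<forall>n. topspace Y \<subseteq> (\<Union>k. U n k)"
  define V where "V n k = {x \<in> topspace X. h x \<in> U n k}" for n k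
  obtain f where f: "\<And>x. x \<in> topspace X \<Longrightarrow> eventually (\<lambda>n. x \<in> V n (f n)) F"
  proof (rule Menger_alongE[OF M, of V])
    show "openin X (V n k)" for n k
      unfolding V_def using U h by (auto intro: openin_continuous_map_preimage)
    show "mono (V n)" for n
      using U(2) unfolding V_def mono_def by blast
    show "topspace X \<subseteq> (\<Union>k. V n k)" for n
    proof
      fix x assume x: "x \<in> topspace X"
      then have "h x \<in> (\<Union>k. U n k)" using U(3)[rule_format, of n] h(2) by blast
      then show "x \<in> (\<Union>k. V n k)" using x by (auto simp: V_def)
    qed
  qed blast
  show "\<exists>f. \<forall>x\<in>topspace Y. eventually (\<lambda>n. x \<in> U n (f n)) F"
  proof (intro exI ballI)
    fix y assume "y \<in> topspace Y"
    then obtain x where "x \<in> topspace X" "y = h x" using h(2) by blast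
    with f[of x] show "eventually (\<lambda>n. y \<in> U n (f n)) F"
      by (auto simp: V_def elim: eventually_mono)
  qed
qed

text \<open>The way back from functions to finite subfamilies: each cover has a countable subcover,
  whose partial unions form an increasing cover.\<close>

lemma Menger_along_selection:
  fixes X :: "'a topology"
  assumes M: "Menger_along F X" and L: "Lindelof_space X"
    and \<U>: "\<And>n. open_cover X (\<U> n)"
  obtains \<F> where "\<And>n. finite (\<F> n)" "\<And>n. \<F> n \<subseteq> \<U> n"
    "\<And>x. x \<in> topspace X \<Longrightarrow> eventually (\<lambda>n. x \<in> \<Union>(\<F> n)) F"
proof -
  have "\<exists>c :: nat \<Rightarrow> 'a set. topspace X \<subseteq> (\<Union>i. c i) \<and> range c \<subseteq> insert {} (\<U> n)" for n
  proof -
    obtain \<V> where \<V>: "countable \<V>" "\<V> \<subseteq> \<U> n" "\<Union>\<V> = topspace X"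
      using L[unfolded Lindelof_space_def, THEN spec, THEN mp, OF \<U>[of n, unfolded open_cover_def]]
      by (elim exE conjE)
    \<comment> \<open>The empty set is inserted so that there is something to enumerate even if the
      subcover is empty; the final intersection with \<open>\<U> n\<close> removes it where it is
      not a member.\<close>
    then have "range (from_nat_into (insert {} \<V>)) = insert {} \<V>"
      by (intro range_from_nat_into) auto
    then show ?thesis using \<V>(2,3) by (intro exI[of _ "from_nat_into (insert {} \<V>)"]) auto
  qed
  then obtain c :: "nat \<Rightarrow> nat \<Rightarrow> 'a set" where c: "\<And>n. topspace X \<subseteq> (\<Union>i. c n i)"
    "\<And>n. range (c n) \<subseteq> insert {} (\<U> n)"
    by (metis (no_types, lifting))
  define U where "U n k = (\<Union>i<k. c n i)" for n k
  obtain f where f: "\<And>x. x \<in> topspace X \<Longrightarrow> eventually (\<lambda>n. x \<in> U n (f n)) F"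
  proof (rule Menger_alongE[OF M, of U])
    have "openin X (c n i)" for n i
    proof -
      have "c n i \<in> insert {} (\<U> n)" using c(2)[of n] by (rule range_subsetD)
      then show ?thesis using \<U>[of n] unfolding open_cover_def by auto
    qed
    then show "openin X (U n k)" for n k unfolding U_def by (intro openin_Union) auto
    show "mono (U n)" for n unfolding U_def by (intro monoI UN_mono) auto
    show "topspace X \<subseteq> (\<Union>k. U n k)" for n
    proof
      fix x assume "x \<in> topspace X"
      then obtain i where "x \<in> c n i" using c(1)[of n] by auto
      then have "x \<in> U n (Suc i)" by (auto simp: U_def)
      then show "x \<in> (\<Union>k. U n k)" by (rule UN_I[OF UNIV_I])
    qed
  qed blast
  show thesis
  proof
    show "finite (c n ` {..<f n} \<inter> \<U> n)" for n by simp
    show "c n ` {..<f n} \<inter> \<U> n \<subseteq> \<U> n" for n by simp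
    show "eventually (\<lambda>n. x \<in> \<Union>(c n ` {..<f n} \<inter> \<U> n)) F" if "x \<in> topspace X" for x
      using f[OF that]
    proof eventually_elim
      case (elim n)
      then obtain i where i: "i < f n" "x \<in> c n i" by (auto simp: U_def)
      moreover have "c n i \<in> \<U> n" using i c(2)[of n] by auto
      ultimately show ?case by blast
    qed
  qed
qed

text \<open>Finitely many points are covered simultaneously for filter-almost all n, and for a
  proper filter this happens at some n.\<close>

lemma Menger_along_imp_Scheepers:
  assumes "Menger_along F X" "Lindelof_space X" "F \<noteq> bot"
  shows "Scheepers X"
  unfolding Scheepers_def
proof (intro allI impI)
  fix \<U> :: "nat \<Rightarrow> 'a set set" assume "\<forall>n. open_cover X (\<U> n)"
  then have cov: "open_cover X (\<U> n)" for n ..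
  obtain \<F> where \<F>: "\<And>n. finite (\<F> n)" "\<And>n. \<F> n \<subseteq> \<U> n"
    "\<And>x. x \<in> topspace X \<Longrightarrow> eventually (\<lambda>n. x \<in> \<Union>(\<F> n)) F"
    by (rule Menger_along_selection[where \<U> = \<U>, OF assms(1,2) cov]) blast
  have "\<exists>n. S \<subseteq> \<Union>(\<F> n)" if "finite S" "S \<subseteq> topspace X" for S
  proof -
    have "eventually (\<lambda>n. \<forall>x\<in>S. x \<in> \<Union>(\<F> n)) F"
      using that \<F>(3) by (intro eventually_ball_finite) auto
    then show ?thesis using eventually_happens'[OF assms(3)] by fast
  qed
  with \<F>(1,2) show "\<exists>\<F>. (\<forall>n. finite (\<F> n) \<and> \<F> n \<subseteq> \<U> n) \<and>
      (\<forall>S. finite S \<and> S \<subseteq> topspace X \<longrightarrow> (\<exists>n. S \<subseteq> \<Union>(\<F> n)))"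
    by (intro exI[of _ \<F>]) simp
qed

lemma Scheepers_imp_Menger:
  assumes "Scheepers X"
  shows "Menger X"
  unfolding Menger_def
proof (intro allI impI)
  fix \<U> :: "nat \<Rightarrow> 'a set set" assume cov: "\<forall>n. open_cover X (\<U> n)"
  from assms[unfolded Scheepers_def, THEN spec, THEN mp, OF cov]
  obtain \<F> where \<F>: "\<forall>n. finite (\<F> n) \<and> \<F> n \<subseteq> \<U> n"
    "\<forall>S. finite S \<and> S \<subseteq> topspace X \<longrightarrow> (\<exists>n. S \<subseteq> \<Union>(\<F> n))"
    by (elim exE conjE)
  have "x \<in> \<Union>(\<Union>n. \<F> n)" if "x \<in> topspace X" for x
    using \<F>(2)[rule_format, of "{x}"] that by auto
  with \<F>(1) show "\<exists>\<F>. (\<forall>n. finite (\<F> n) \<and> \<F> n \<subseteq> \<U> n) \<and> topspace X \<subseteq> \<Union>(\<Union>n. \<F> n)"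
    by (intro exI[of _ \<F>]) (simp add: subset_iff)
qed

text \<open>For each \<open>n\<close> there are only finitely many sets \<open>a \<subseteq> {..<n}\<close>, so around a fixed first
  coordinate finitely many members of the \<open>n\<close>-th cover catch all sets that omit a sufficiently
  long interval starting at \<open>n\<close>.\<close>

lemma Menger_along_prod:
  fixes F :: "nat filter" and Z :: "nat set set" and r :: "'b rel"
  assumes M: "Menger_along F T"
    and fin: "\<And>a. finite a \<Longrightarrow> a \<in> Z"
    and gaps: "\<And>g :: nat \<Rightarrow> nat. |{z\<in>Z. \<not> eventually (\<lambda>m. z \<inter> {m..<g m} = {}) F}| <o r"
    and bdd: "\<And>I :: (nat \<Rightarrow> nat) set. |I| <o r \<Longrightarrow> \<exists>g. \<forall>f\<in>I. eventually (\<lambda>m. f m \<le> g m) F"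
  shows "Menger_along F (prod_topology T (top_of_set (ternary ` Z)))" (is "Menger_along F ?P")
  unfolding Menger_along_def
proof safe
  let ?X = "top_of_set (ternary ` Z)"
  fix U :: "nat \<Rightarrow> nat \<Rightarrow> ('a \<times> real) set"
  assume U0: "\<forall>n k. openin ?P (U n k)" "\<forall>n. mono (U n)" "\<forall>n. topspace ?P \<subseteq> (\<Union>k. U n k)"
  have U: "openin ?P (U n k)" "i \<le> j \<Longrightarrow> U n i \<subseteq> U n j" for n k i j
    using U0(1,2) by (simp_all add: monoD)
  have cov: "\<exists>k. (t, ternary z) \<in> U n k" if "t \<in> topspace T" "z \<in> Z" for n t z
  proof -
    have "(t, ternary z) \<in> topspace ?P" using that by simp
    then show ?thesis using U0(3) by blast
  qed
  \<comment> \<open>\<open>V n m\<close> is the largest open set over which all of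
    \<open>B n m\<close> is caught by \<open>U n m\<close>. Since \<open>B n m\<close> shrinks as m
    grows, the \<open>V n\<close> increase, so the property of \<open>T\<close> applies to
    them.\<close>
  define B where "B n m = ternary ` {a\<in>Z. a \<inter> {n..<m} = {}}" for n m :: nat
  define V where "V n m = \<Union>{V. openin T V \<and> V \<times> B n m \<subseteq> U n m}" for n m
  have Vcov: "topspace T \<subseteq> (\<Union>m. V n m)" for n
  proof
    fix t assume t: "t \<in> topspace T"
    \<comment> \<open>One neighbourhood for each of the finitely many subsets of {..<n}; they lie in
      \<open>Z\<close> by \<open>fin\<close>.\<close>
    have "\<exists>k V W. openin T V \<and> openin ?X W \<and> t \<in> V \<and> ternary a \<in> W \<and> V \<times> W \<subseteq> U n k"
      if "a \<in> Pow {..<n}" for a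
    proof -
      have "finite a" using that finite_subset by blast
      then obtain k where k: "(t, ternary a) \<in> U n k" using cov[OF t fin] by blast
      show ?thesis
        using U(1)[of n k, unfolded openin_prod_topology_alt, rule_format, OF k] by (rule exI[of _ k])
    qed
    then obtain k V' W where kVW: "\<And>a. a \<in> Pow {..<n} \<Longrightarrow> openin T (V' a) \<and> openin ?X (W a) \<and>
        t \<in> V' a \<and> ternary a \<in> W a \<and> V' a \<times> W a \<subseteq> U n (k a)"
      by metis
    have "\<exists>l. \<forall>b\<in>Z. b \<inter> {..<l} = a \<inter> {..<l} \<longrightarrow> ternary b \<in> W a" if "a \<in> Pow {..<n}" for a
      using kVW[OF that] ternary_nbhd[of Z "W a" a] by metis
    then obtain l where l: "\<And>a b. a \<in> Pow {..<n} \<Longrightarrow> b \<in> Z \<Longrightarrow> b \<inter> {..<l a} = a \<inter> {..<l a} \<Longrightarrow> ternary b \<in> W a"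
      by metis
    \<comment> \<open>Past all the indices \<open>k a\<close> and digit lengths \<open>l a\<close>:
      a set omitting [n, m) then agrees with its trace below n on all the digits that
      matter.\<close>
    define m where "m = Max ((\<lambda>a. max (k a) (l a)) ` Pow {..<n})"
    have m: "k a \<le> m" "l a \<le> m" if "a \<in> Pow {..<n}" for a
    proof -
      have "max (k a) (l a) \<le> m" unfolding m_def using that by (intro Max_ge) auto
      then show "k a \<le> m" "l a \<le> m" by auto
    qed
    define N where "N = (\<Inter>a\<in>Pow {..<n}. V' a)"
    have "openin T N" unfolding N_def using kVW by (intro openin_INT2) auto
    moreover have "N \<times> B n m \<subseteq> U n m"
    proof
      fix p assume "p \<in> N \<times> B n m"
      then obtain s b where p: "p = (s, ternary b)" "s \<in> N" "b \<in> Z" "b \<inter> {n..<m} = {}"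
        by (auto simp: B_def)
      define a where "a = b \<inter> {..<n}"
      have a: "a \<in> Pow {..<n}" by (auto simp: a_def)
      have "b \<inter> {..<l a} = a \<inter> {..<l a}"
        using p(4) m(2)[OF a] by (fastforce simp: a_def)
      then have "ternary b \<in> W a" using l a p by blast
      moreover have "s \<in> V' a" using p(2) a by (auto simp: N_def)
      ultimately have "p \<in> U n (k a)" using kVW[OF a] p(1) by blast
      then show "p \<in> U n m" using U(2)[OF m(1)[OF a]] by blast
    qed
    moreover have "t \<in> N" using kVW by (auto simp: N_def)
    ultimately show "t \<in> (\<Union>m. V n m)" unfolding V_def by blast
  qed
  have Vmono: "mono (V n)" for n
  proof (rule monoI)
    fix i j :: nat assume ij: "i \<le> j"
    have "B n j \<subseteq> B n i" using ij by (fastforce simp: B_def)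
    then have "A \<times> B n j \<subseteq> U n j" if "A \<times> B n i \<subseteq> U n i" for A
      using U(2)[OF ij, of n] that by blast
    then show "V n i \<subseteq> V n j" unfolding V_def by blast
  qed
  have Vopen: "openin T (V n m)" for n m unfolding V_def by (rule openin_Union) simp
  obtain f where f: "\<And>t. t \<in> topspace T \<Longrightarrow> eventually (\<lambda>n. t \<in> V n (f n)) F"
    by (rule Menger_alongE[where U = V, OF M Vopen Vmono Vcov]) blast
  \<comment> \<open>The exceptional sets, for which \<open>f\<close> is not enough. Each of their
    slices is handled by the property of \<open>T\<close> alone, and since there are few of them,
    \<open>bdd\<close> merges the resulting functions into one.\<close>
  define Z' where "Z' = {z\<in>Z. \<not> eventually (\<lambda>m. z \<inter> {m..<f m} = {}) F}"
  have "\<exists>h. \<forall>t\<in>topspace T. eventually (\<lambda>n. (t, ternary z) \<in> U n (h n)) F" if z: "z \<in> Z" for z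
  proof -
    define S where "S n k = {t\<in>topspace T. (t, ternary z) \<in> U n k}" for n k
    have S: "openin T (S n k)" for n k
      unfolding S_def using z
      by (intro openin_continuous_map_preimage[OF _ U(1)] continuous_map_pairedI) auto
    have S': "mono (S n)" for n using U(2) unfolding S_def mono_def by blast
    have S'': "topspace T \<subseteq> (\<Union>k. S n k)" for n using cov[OF _ z] by (auto simp: S_def)
    obtain h where "\<And>t. t \<in> topspace T \<Longrightarrow> eventually (\<lambda>n. t \<in> S n (h n)) F"
      by (rule Menger_alongE[where U = S, OF M S S' S'']) blast
    then show ?thesis unfolding S_def by auto
  qed
  then obtain h where h: "\<And>z t. z \<in> Z \<Longrightarrow> t \<in> topspace T \<Longrightarrow>
      eventually (\<lambda>n. (t, ternary z) \<in> U n (h z n)) F"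
    by metis
  have "|h ` Z'| <o r"
    using ordLeq_ordLess_trans[OF card_of_image gaps[of f]] unfolding Z'_def .
  from bdd[OF this] obtain g where g: "\<And>z. z \<in> Z' \<Longrightarrow> eventually (\<lambda>m. h z m \<le> g m) F"
    by auto
  show "\<exists>f. \<forall>x\<in>topspace ?P. eventually (\<lambda>n. x \<in> U n (f n)) F"
  proof (intro exI ballI)
    fix x assume "x \<in> topspace ?P"
    then obtain t z where x: "x = (t, ternary z)" "t \<in> topspace T" "z \<in> Z" by auto
    show "eventually (\<lambda>n. x \<in> U n (max (f n) (g n))) F"
    proof (cases "z \<in> Z'")
      case True
      from g[OF True] h[OF x(3,2)] show ?thesis
      proof eventually_elim
        case (elim n)
        then show ?case using U(2)[of "h z n" "max (f n) (g n)" n] x(1) by fastforce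
      qed
    next
      case False
      then have "eventually (\<lambda>m. z \<inter> {m..<f m} = {}) F" using x(3) by (auto simp: Z'_def)
      then show ?thesis using f[OF x(2)]
      proof eventually_elim
        case (elim n)
        then have "ternary z \<in> B n (f n)" using x(3) by (auto simp: B_def)
        then have "x \<in> U n (f n)" using elim x(1) unfolding V_def by blast
        then show ?case using U(2)[of "f n" "max (f n) (g n)" n] by fastforce
      qed
    qed
  qed
qed

lemma Lindelof_space_top_of_set:
  "Lindelof_space (top_of_set (S :: 'a::second_countable_topology set))"
proof -
  obtain B :: "'a set set" where B: "countable B" "\<And>U. U \<in> B \<Longrightarrow> open U"
    "\<And>S. open S \<Longrightarrow> \<exists>U. U \<subseteq> B \<and> S = \<Union>U"
    by (rule univ_second_countable) blast
  have "\<exists>V\<in>B. x \<in> V \<and> V \<subseteq> U" if U: "open U" "x \<in> U" for U x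
  proof -
    obtain \<U> where "\<U> \<subseteq> B" "U = \<Union>\<U>" using B(3)[OF U(1)] by (elim exE conjE)
    then show ?thesis using U(2) by blast
  qed
  then have "second_countable (euclidean :: 'a topology)"
    unfolding second_countable_def using B(1,2) by (intro exI[of _ B]) simp
  then show ?thesis
    by (rule second_countable_imp_Lindelof_space[OF second_countable_subtopology])
qed

text \<open>A finite power is the image, under restriction to {..<n}, of a subspace of the second
  countable space of all sequences.\<close>

lemma Lindelof_space_finite_power:
  fixes X :: "'a::second_countable_topology set"
  shows "Lindelof_space (finite_power (top_of_set X) n)"
proof -
  define S where "S = {f. (\<forall>i<n. f i \<in> X)}"
  have "continuous_map (top_of_set S) (finite_power (top_of_set X) n) (\<lambda>f. restrict f {..<n})"
    unfolding finite_power_def continuous_map_componentwise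
  proof (intro conjI ballI)
    fix k assume k: "k \<in> {..<n}"
    have "continuous_on S (\<lambda>f. f k)"
      by (rule continuous_on_subset[OF continuous_on_product_coordinates]) simp
    then show "continuous_map (top_of_set S) (top_of_set X) (\<lambda>f. restrict f {..<n} k)"
      using k by (auto simp: S_def continuous_map_in_subtopology)
  qed auto
  moreover have "(\<lambda>f. restrict f {..<n}) ` topspace (top_of_set S) = topspace (finite_power (top_of_set X) n)"
  proof -
    have "f \<in> (\<lambda>f. restrict f {..<n}) ` S" if "f \<in> {..<n} \<rightarrow>\<^sub>E X" for f
      using that by (intro image_eqI[of _ _ f]) (auto simp: S_def PiE_iff extensional_restrict)
    moreover have "(\<lambda>f. restrict f {..<n}) ` S \<subseteq> {..<n} \<rightarrow>\<^sub>E X"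
    proof
      fix g assume "g \<in> (\<lambda>f. restrict f {..<n}) ` S"
      then obtain f where "f \<in> S" "g = restrict f {..<n}" by blast
      then show "g \<in> {..<n} \<rightarrow>\<^sub>E X" by (simp add: S_def restrict_PiE_iff del: restrict_PiE)
    qed
    ultimately show ?thesis by (auto simp: finite_power_def)
  qed
  ultimately show ?thesis
    by (rule Lindelof_space_continuous_map_image[OF Lindelof_space_top_of_set])
qed

text \<open>The zeroth power is a single point; the next power is the image of a product under
  writing the new coordinate at position n.\<close>

lemma Menger_along_finite_power:
  fixes X :: "'a topology"
  assumes prod: "\<And>T :: (nat \<Rightarrow> 'a) topology. Menger_along F T \<Longrightarrow> Menger_along F (prod_topology T X)"
  shows "Menger_along F (finite_power X n)"
proof (induction n)
  case 0
  have one: "topspace (finite_power X 0) = {\<lambda>_. undefined}" by (simp add: finite_power_def)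
  show ?case unfolding Menger_along_def one
  proof (intro allI impI)
    fix U :: "nat \<Rightarrow> nat \<Rightarrow> (nat \<Rightarrow> 'a) set"
    assume "(\<forall>n k. openin (finite_power X 0) (U n k)) \<and> (\<forall>n. mono (U n)) \<and>
      (\<forall>n. {\<lambda>_. undefined} \<subseteq> (\<Union>k. U n k))"
    then have "\<exists>f. \<forall>n. (\<lambda>_. undefined) \<in> U n (f n)" by (intro choice) auto
    then obtain f where "\<forall>n. (\<lambda>_. undefined) \<in> U n (f n)" ..
    then show "\<exists>f. \<forall>x\<in>{\<lambda>_. undefined}. eventually (\<lambda>n. x \<in> U n (f n)) F"
      by (intro exI[of _ f]) simp
  qed
next
  case (Suc n)
  let ?h = "\<lambda>(t, x). t(n := x)"
  show ?case
  proof (rule Menger_along_image[where h = ?h, OF prod[OF Suc.IH]])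
    show "continuous_map (prod_topology (finite_power X n) X) (finite_power X (Suc n)) ?h"
      unfolding finite_power_def continuous_map_componentwise
    proof (intro conjI ballI)
      fix k assume k: "k \<in> {..<Suc n}"
      have "continuous_map (prod_topology (product_topology (\<lambda>_. X) {..<n}) X) X (\<lambda>p. fst p k)" if "k < n"
      proof -
        have "continuous_map (product_topology (\<lambda>_. X) {..<n}) X (\<lambda>t. t k)"
          using that continuous_map_product_projection[of k "{..<n}" "\<lambda>_. X"] by simp
        from continuous_map_compose[OF continuous_map_fst this] show ?thesis
          by (simp add: o_def)
      qed
      then show "continuous_map (prod_topology (product_topology (\<lambda>_. X) {..<n}) X) X (\<lambda>p. ?h p k)"
        using k continuous_map_snd by (cases "k = n") (auto simp: case_prod_beta o_def)
    qed (auto simp: extensional_def PiE_def)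
    \<comment> \<open>Members of the n-th power are extensional, so the entry at n must be reset to
      \<open>undefined\<close> in the preimage.\<close>
    have "y \<in> ?h ` (({..<n} \<rightarrow>\<^sub>E topspace X) \<times> topspace X)" if "y \<in> {..<Suc n} \<rightarrow>\<^sub>E topspace X" for y
      using that by (intro image_eqI[of _ _ "(y(n := undefined), y n)"]) (auto simp: PiE_iff extensional_def)
    then show "?h ` topspace (prod_topology (finite_power X n) X) = topspace (finite_power X (Suc n))"
      by (auto simp: finite_power_def PiE_iff extensional_def)
  qed
qed

section \<open>Sets with long gaps\<close>

locale regular_uncountable =
  fixes r :: "'k rel"
  assumes Cinfinite: "Cinfinite r"
    and regular: "regularCard r"
    and uncountable: "|UNIV :: nat set| <o r"
begin

lemma Card_order: "Card_order r"
  using Cinfinite by simp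

lemma Well_order: "Well_order r"
  using Card_order unfolding card_order_on_def by simp

lemma small_subset: "|B| <o r" if "|A| <o r" "B \<subseteq> A"
  by (rule ordLeq_ordLess_trans[OF card_of_mono1[OF that(2)] that(1)])

lemma small_image: "|f ` A| <o r" if "|A| <o r"
  by (rule ordLeq_ordLess_trans[OF card_of_image that])

lemma small_UN: "|\<Union>i\<in>I. A i| <o r" if "|I| <o r" "\<And>i. i \<in> I \<Longrightarrow> |A i| <o r"
  by (rule card_of_UNION_ordLess_infinite_Field_regularCard[OF regular Cinfinite that(1)])
    (intro ballI that(2))

lemma small_countable: "|A| <o r" if A: "countable A"
proof -
  obtain f :: "_ \<Rightarrow> nat" where "inj_on f A" using A by (rule countableE)
  then have "|A| \<le>o |UNIV :: nat set|" by (rule card_of_ordLeqI) simp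
  then show ?thesis using uncountable by (rule ordLeq_ordLess_trans)
qed

lemma small_Un: "|A \<union> B| <o r" if "|A| <o r" "|B| <o r"
proof -
  have "|\<Union>b\<in>UNIV. if b then A else B| <o r"
    using that by (intro small_UN[OF small_countable]) auto
  then show ?thesis by (rule small_subset) (auto split: if_splits)
qed

text \<open>Sets of size n + 1 arise by inserting a point of \<open>A\<close> into sets of size n;
  the countably many sizes are then united.\<close>

lemma small_finite_subsets: "|{T. T \<subseteq> A \<and> finite T}| <o r" if A: "|A| <o r"
proof -
  let ?F = "\<lambda>n. {T. T \<subseteq> A \<and> finite T \<and> card T = n}"
  have "|?F n| <o r" for n
  proof (induction n)
    case 0
    have "?F 0 \<subseteq> {{}}" by auto
    then show ?case by (rule small_subset[OF small_countable, rotated]) simp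
  next
    case (Suc n)
    have "|\<Union>a\<in>A. insert a ` ?F n| <o r"
      by (intro small_UN A small_image Suc)
    moreover have "?F (Suc n) \<subseteq> (\<Union>a\<in>A. insert a ` ?F n)"
    proof
      fix T assume T: "T \<in> ?F (Suc n)"
      then have "T \<noteq> {}" by auto
      then obtain a where "a \<in> T" by blast
      then have "a \<in> A" "T - {a} \<in> ?F n" "T = insert a (T - {a})" using T by auto
      then show "T \<in> (\<Union>a\<in>A. insert a ` ?F n)" by blast
    qed
    ultimately show ?case by (rule small_subset)
  qed
  then have "|\<Union>n. ?F n| <o r" by (intro small_UN[OF small_countable]) simp_all
  then show ?thesis by (rule small_subset) auto
qed

lemma small_underS: "|underS r c| <o r"
proof (cases "c \<in> Field r")
  case True
  then show ?thesis by (rule card_of_underS[OF Card_order])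
next
  case False
  then have "underS r c = {}" unfolding underS_def Field_def by blast
  then show ?thesis by (simp add: small_countable)
qed

lemma small_under: "|under r c| <o r"
proof (rule small_subset)
  show "|underS r c \<union> {c}| <o r" by (intro small_Un small_underS small_countable) simp
  show "under r c \<subseteq> underS r c \<union> {c}" unfolding under_def underS_def by blast
qed

lemma wo_rel_r: "wo_rel r"
  using Well_order by (simp add: wo_rel_def)

lemma refl_r: "c \<in> Field r \<Longrightarrow> (c, c) \<in> r"
  by (rule refl_onD[OF wo_rel.REFL[OF wo_rel_r]])

lemma trans_r: "(a, b) \<in> r \<Longrightarrow> (b, c) \<in> r \<Longrightarrow> (a, c) \<in> r"
  by (rule transD[OF wo_rel.TRANS[OF wo_rel_r]])

lemma linear_r: "a \<in> Field r \<Longrightarrow> b \<in> Field r \<Longrightarrow> (a, b) \<in> r \<or> (b, a) \<in> r"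
  using wo_rel.TOTALS[OF wo_rel_r] by simp

text \<open>By regularity every cofinal subset has full cardinality, so a smaller subset is not
  cofinal, and by linearity it is bounded.\<close>

lemma small_bounded:
  assumes "|B| <o r" "B \<subseteq> Field r"
  obtains c where "c \<in> Field r" "\<And>b. b \<in> B \<Longrightarrow> (b, c) \<in> r"
proof -
  have "\<not> cofinal B r"
  proof
    assume "cofinal B r"
    then have "|B| =o r" using regular assms(2) unfolding regularCard_def by simp
    then show False using not_ordLess_ordIso[OF assms(1)] by simp
  qed
  then obtain c where c: "c \<in> Field r" "\<forall>b\<in>B. \<not> (c \<noteq> b \<and> (c, b) \<in> r)"
    unfolding cofinal_def by blast
  have "(b, c) \<in> r" if "b \<in> B" for b
  proof -
    have "b \<in> Field r" using that assms(2) by (rule subsetD[rotated])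
    then show ?thesis using c(2)[rule_format, OF that] linear_r[OF c(1)] refl_r by auto
  qed
  then show thesis by (rule that[OF c(1)])
qed

end

section \<open>Gaps, blocks and the extension of two centered families by one step\<close>

definition next_in :: "nat set \<Rightarrow> nat \<Rightarrow> nat" where
  "next_in A n = (LEAST m. m \<in> A \<and> n \<le> m)"

lemma next_in:
  assumes "infinite A"
  shows "next_in A n \<in> A" "n \<le> next_in A n"
proof -
  obtain m where "m \<in> A" "n \<le> m"
    using assms unfolding infinite_nat_iff_unbounded_le by blast
  then have "next_in A n \<in> A \<and> n \<le> next_in A n"
    unfolding next_in_def using LeastI[of "\<lambda>k. k \<in> A \<and> n \<le> k" m] by simp
  then show "next_in A n \<in> A" "n \<le> next_in A n" by simp_all
qed

lemma mono_next_in: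
  assumes "infinite A"
  shows "mono (next_in A)"
proof (rule monoI)
  fix i j :: nat assume "i \<le> j"
  then have "i \<le> next_in A j" using next_in(2)[OF assms, of j] by simp
  then show "next_in A i \<le> next_in A j"
    unfolding next_in_def[of A i] using next_in(1)[OF assms] by (simp add: Least_le)
qed

definition gaps :: "nat set \<Rightarrow> (nat \<Rightarrow> nat) \<Rightarrow> nat set" where
  "gaps x e = {m. x \<inter> {m..<e m} = {}}"

text \<open>Intersections are asked to be infinite because a later step must find in each of them
  starting points of gaps beyond every bound.\<close>

definition centered :: "nat set set \<Rightarrow> bool" where
  "centered \<A> \<longleftrightarrow> (\<forall>S. finite S \<longrightarrow> S \<subseteq> \<A> \<longrightarrow> infinite (\<Inter>S))"

text \<open>If \<open>h\<close> is not dominated by the iterates of \<open>\<delta> \<circ> f\<close>, then an orbit that always jumps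
  to at least \<open>\<delta> (h k)\<close> cannot stay below those iterates, so it overtakes \<open>f\<close> infinitely often.\<close>

lemma overtaking_orbit:
  fixes \<delta> h f p s :: "nat \<Rightarrow> nat"
  assumes \<delta>: "mono \<delta>" "\<And>n. n \<le> \<delta> n" and f: "mono f" "\<And>n. n \<le> f n"
    and p: "\<And>k. p (Suc k) = \<delta> (s k)" and s: "\<And>k. h k \<le> s k"
    and h: "\<And>c. infinite {k. f (((\<delta> \<circ> f) ^^ k) c) < h k}"
  shows "infinite {k. f (p k) \<le> s k}"
proof
  assume "finite {k. f (p k) \<le> s k}"
  then obtain k0 where k0: "\<forall>k\<in>{k. f (p k) \<le> s k}. k < k0"
    unfolding finite_nat_set_iff_bounded by (elim exE)
  have less: "s k < f (p k)" if "k0 \<le> k" for k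
  proof (rule ccontr)
    assume "\<not> s k < f (p k)"
    then have "k < k0" using k0 by simp
    then show False using that by simp
  qed
  \<comment> \<open>The start \<open>p k0\<close> is not known in advance, hence the assumption on
    \<open>h\<close> for every \<open>c\<close>. The comparison with \<open>p\<close> is shifted by
    \<open>k0\<close>; monotonicity of \<open>q\<close> absorbs the shift.\<close>
  define q where "q k = ((\<delta> \<circ> f) ^^ k) (p k0)" for k
  have q_Suc: "q (Suc k) = \<delta> (f (q k))" for k by (simp add: q_def)
  have "q k \<le> q (Suc k)" for k
    unfolding q_Suc using \<delta>(2) f(2) by (rule le_trans[rotated])
  then have q_mono: "mono q" by (rule mono_iff_le_Suc[THEN iffD2, rule_format])
  have pq: "p (k0 + j) \<le> q j" for j
  proof (induction j)
    case 0
    then show ?case by (simp add: q_def)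
  next
    case (Suc j)
    have "p (k0 + Suc j) = \<delta> (s (k0 + j))" using p by simp
    also have "\<dots> \<le> \<delta> (f (p (k0 + j)))"
      using less[of "k0 + j"] by (intro monoD[OF \<delta>(1)]) simp
    also have "\<dots> \<le> \<delta> (f (q j))"
      by (intro monoD[OF \<delta>(1)] monoD[OF f(1)] Suc)
    finally show ?case by (simp add: q_Suc)
  qed
  have "\<not> f (q k) < h k" if "k0 \<le> k" for k
  proof -
    have "p k \<le> q (k - k0)" using pq[of "k - k0"] that by simp
    also have "\<dots> \<le> q k" by (intro monoD[OF q_mono]) simp
    finally have "f (p k) \<le> f (q k)" by (rule monoD[OF f(1)])
    then show ?thesis using less[OF that] s[of k] by simp
  qed
  then have "{k. f (q k) < h k} \<subseteq> {..<k0}"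
    by (intro subsetI) (simp, rule ccontr, simp)
  then have "finite {k. f (q k) < h k}" by (rule finite_subset) simp
  then show False using h[of "p k0"] by (simp add: q_def)
qed

text \<open>The two assumptions say that r is at most the dominating number and at most the reaping
  number; later r is \<open>\<dd>\<close> itself.\<close>

locale d_le_r = regular_uncountable r for r :: "'k rel" +
  assumes undominated: "\<And>Q :: (nat \<Rightarrow> nat) set. |Q| <o r \<Longrightarrow> \<exists>h. \<forall>q\<in>Q. infinite {k. q k < h k}"
    and reapable: "\<And>A. A \<subseteq> inf_sets \<Longrightarrow> |A| <o r \<Longrightarrow> \<exists>R\<in>inf_sets. reaps R A"
begin

text \<open>For every \<open>A\<close> and \<open>e\<close>, infinitely many blocks [p k, s k) are
  long enough that a gap of length prescribed by \<open>e\<close>, started at the first element of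
  \<open>A\<close> from \<open>p k\<close> on, fits inside. Few pairs \<open>A\<close>,
  \<open>e\<close> give few functions, so one \<open>h\<close> escapes them all and
  \<open>overtaking_orbit\<close> applies.\<close>

lemma block_sequence:
  assumes H: "|H| <o r" "\<And>A. A \<in> H \<Longrightarrow> infinite A"
    and E: "|E| <o r" "\<And>e. e \<in> E \<Longrightarrow> mono (e :: nat \<Rightarrow> nat)"
    and \<delta>: "mono \<delta>" "\<And>n. n < \<delta> n"
  obtains p s :: "nat \<Rightarrow> nat" where "\<And>k. p k < s k" "\<And>k. p (Suc k) = \<delta> (s k)"
    "\<And>A e. A \<in> H \<Longrightarrow> e \<in> E \<Longrightarrow> infinite {k. e (next_in A (p k)) \<le> s k}"
proof -
  \<comment> \<open>The summand n puts \<open>f A e\<close> above the identity, as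
    \<open>overtaking_orbit\<close> demands.\<close>
  define f where "f A e n = n + e (next_in A n)" for A and e :: "nat \<Rightarrow> nat" and n
  define Q where "Q = (\<Union>A\<in>H. \<Union>e\<in>E. range (\<lambda>c k. f A e (((\<delta> \<circ> f A e) ^^ k) c)))"
  have "|Q| <o r"
    unfolding Q_def by (intro small_UN small_image small_countable H E) simp_all
  from undominated[OF this] obtain h where h: "\<forall>q\<in>Q. infinite {k. q k < h k}" ..
  \<comment> \<open>The maximum puts the end of each block above \<open>h k\<close> and keeps the
    block nonempty.\<close>
  define p where "p = rec_nat 0 (\<lambda>k v. \<delta> (max (h k) (Suc v)))"
  define s where "s k = max (h k) (Suc (p k))" for k
  have p_Suc: "p (Suc k) = \<delta> (s k)" for k by (simp add: p_def s_def)
  show thesis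
  proof
    show "p k < s k" for k by (simp add: s_def)
    show "p (Suc k) = \<delta> (s k)" for k by (rule p_Suc)
    fix A e assume A: "A \<in> H" and e: "e \<in> E"
    have "mono (f A e)"
    proof (rule monoI)
      fix i j :: nat assume "i \<le> j"
      then show "f A e i \<le> f A e j"
        unfolding f_def by (intro add_mono monoD[OF E(2)[OF e]] monoD[OF mono_next_in[OF H(2)[OF A]]])
    qed
    moreover have "infinite {k. f A e (((\<delta> \<circ> f A e) ^^ k) c) < h k}" for c
    proof -
      have "(\<lambda>k. f A e (((\<delta> \<circ> f A e) ^^ k) c)) \<in> Q"
        unfolding Q_def by (rule UN_I[OF A], rule UN_I[OF e], rule range_eqI[where x = c], rule refl)
      from bspec[OF h this] show ?thesis .
    qed
    ultimately have "infinite {k. f A e (p k) \<le> s k}"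
      using less_imp_le[OF \<delta>(2)]
      by (intro overtaking_orbit[where h = h and \<delta> = \<delta> and f = "f A e"] \<delta>(1) p_Suc)
        (simp_all add: f_def s_def)
    then show "infinite {k. e (next_in A (p k)) \<le> s k}"
      by (rule infinite_super[rotated]) (auto simp: f_def)
  qed
qed

text \<open>The two sets are the complements of two complementary unions of the blocks
  \<open>{p k..<s k}\<close>, the index set of the first being split by a reaping set. Since
  \<open>p (Suc k) = \<delta> (s k)\<close>, an interval \<open>{n..<\<delta> n}\<close> meets at most one block.\<close>

lemma two_sets_with_gaps:
  assumes H: "|H| <o r" "\<And>A. A \<in> H \<Longrightarrow> infinite A"
    and E: "|E| <o r" "\<And>e. e \<in> E \<Longrightarrow> mono (e :: nat \<Rightarrow> nat)"
    and \<delta>: "mono \<delta>" "\<And>n. n < \<delta> n"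
  obtains x y where "infinite x" "infinite y"
    "\<And>A e. A \<in> H \<Longrightarrow> e \<in> E \<Longrightarrow> infinite (A \<inter> gaps x e) \<and> infinite (A \<inter> gaps y e)"
    "\<And>n. {n..<\<delta> n} \<subseteq> x \<or> {n..<\<delta> n} \<subseteq> y"
proof -
  obtain p s where ps: "\<And>k. p k < s k" "\<And>k. p (Suc k) = \<delta> (s k)"
    and inf: "\<And>A e. A \<in> H \<Longrightarrow> e \<in> E \<Longrightarrow> infinite {k. e (next_in A (p k)) \<le> s k}"
    by (rule block_sequence[OF H E \<delta>]) blast+
  \<comment> \<open>0 is removed because \<open>inf_sets\<close> contains only sets of positive
    numbers.\<close>
  define K where "K A e = {k. e (next_in A (p k)) \<le> s k} - {0}" for A and e :: "nat \<Rightarrow> nat"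
  have K_inf: "infinite (K A e)" if "A \<in> H" "e \<in> E" for A e
    unfolding K_def using inf[OF that] by simp
  define \<K> where "\<K> = (\<Union>A\<in>H. K A ` E)"
  have K_small: "|\<K>| <o r" unfolding \<K>_def by (intro small_UN small_image H E)
  have "\<K> \<subseteq> inf_sets" using K_inf by (auto simp: \<K>_def inf_sets_def K_def)
  from reapable[OF this K_small] obtain R where R0: "reaps R \<K>" by (elim bexE)
  have R: "infinite (K A e \<inter> R)" "infinite (K A e \<inter> - R)" if "A \<in> H" "e \<in> E" for A e
  proof -
    have "K A e \<in> \<K>" unfolding \<K>_def by (rule UN_I[OF that(1)], rule imageI, rule that(2))
    then show "infinite (K A e \<inter> R)" "infinite (K A e \<inter> - R)"
      using R0 by (simp_all add: reaps_def Diff_eq)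
  qed
  define w where "w T = - (\<Union>k\<in>T. {p k..<s k})" for T
  have s_less_p: "s k < p k'" if "k < k'" for k k'
  proof -
    have "s k < p (Suc k)" using \<delta>(2) ps(2) by simp
    also have "p (Suc k) \<le> p k'"
    proof (rule lift_Suc_mono_le[of p])
      show "p i \<le> p (Suc i)" for i
        using ps(1)[of i] \<delta>(2)[of "s i"] ps(2)[of i] by simp
      show "Suc k \<le> k'" using that by simp
    qed
    finally show ?thesis .
  qed
  have p_ge: "k \<le> p k" for k
  proof (induction k)
    case (Suc k)
    then show ?case using ps(1)[of k] s_less_p[of k "Suc k"] by simp
  qed simp
  \<comment> \<open>The end of a block is not part of it and precedes the next block, so it belongs
    to every \<open>w T\<close>; this makes \<open>w T\<close> infinite.\<close>
  have s_in: "s k \<in> w T" for k T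
  proof -
    have "\<not> (p j \<le> s k \<and> s k < s j)" for j
      using s_less_p[of k j] s_less_p[of j k] ps(1)[of k] by (cases j k rule: linorder_cases) auto
    then show ?thesis by (auto simp: w_def)
  qed
  have w_inf: "infinite (w T)" for T
  proof (rule infinite_super)
    show "range s \<subseteq> w T" using s_in by blast
    have "strict_mono s" using s_less_p ps(1) by (intro strict_monoI) (meson less_trans)
    then show "infinite (range s)" by (intro range_inj_infinite strict_mono_imp_inj_on)
  qed
  have w_gaps: "infinite (A \<inter> gaps (w T) e)"
    if A: "A \<in> H" and T: "infinite (K A e \<inter> T)" for A e T
    unfolding infinite_nat_iff_unbounded_le
  proof
    fix n
    obtain k where k: "n \<le> k" "k \<in> K A e" "k \<in> T"
      using T unfolding infinite_nat_iff_unbounded_le by blast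
    let ?m = "next_in A (p k)"
    have m: "?m \<in> A" "p k \<le> ?m" using next_in[OF H(2)[OF A]] by blast+
    \<comment> \<open>By the choice of \<open>k\<close> in \<open>K A e\<close>, the gap from ?m
      ends by \<open>s k\<close>, within a block that \<open>w T\<close> omits.\<close>
    have "{?m..<e ?m} \<subseteq> {p k..<s k}" using k(2) m(2) by (auto simp: K_def)
    then have "?m \<in> gaps (w T) e" using k(3) unfolding gaps_def w_def by blast
    moreover have "n \<le> ?m" using k(1) p_ge[of k] m(2) by simp
    ultimately show "\<exists>m\<ge>n. m \<in> A \<inter> gaps (w T) e" using m(1) by blast
  qed
  have "{n..<\<delta> n} \<subseteq> w R \<or> {n..<\<delta> n} \<subseteq> w (- R)" for n
  proof (rule ccontr)
    assume "\<not> ({n..<\<delta> n} \<subseteq> w R \<or> {n..<\<delta> n} \<subseteq> w (- R))"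
    then obtain i j k l where ij: "i \<in> {n..<\<delta> n}" "j \<in> {n..<\<delta> n}"
      "k \<in> R" "l \<in> - R" "i \<in> {p k..<s k}" "j \<in> {p l..<s l}"
      unfolding w_def by blast
    \<comment> \<open>An interval from n that meets block k has n < s k, hence it ends by \<delta>
      (s k) = p (Suc k) and misses all later blocks.\<close>
    have no: False if "i \<in> {n..<\<delta> n}" "j \<in> {n..<\<delta> n}"
      "i \<in> {p k..<s k}" "j \<in> {p l..<s l}" "k < l" for i j k l
    proof -
      have "\<delta> n \<le> \<delta> (s k)" using that(1,3) by (intro monoD[OF \<delta>(1)]) simp
      also have "\<delta> (s k) = p (Suc k)" using ps(2) by simp
      also have "p (Suc k) \<le> p l"
        using that(5) s_less_p[of "Suc k" l] ps(1)[of "Suc k"] by (cases "Suc k = l") auto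
      finally show False using that(2,4) by simp
    qed
    have "k \<noteq> l" using ij by auto
    then show False
      using no[OF ij(1,2,5,6)] no[OF ij(2,1,6,5)] by (meson nat_neq_iff)
  qed
  then show thesis using that[of "w R" "w (- R)"] w_inf w_gaps R by blast
qed

text \<open>The previous lemma is applied to all finite intersections of the families and all finite
  sums from \<open>E\<close>. A sum bounds each of its terms, so the start of a gap for the sum is
  the start of a gap for every term; both closures remain small.\<close>

lemma centered_extension:
  assumes \<A>: "|\<A>| <o r" "centered \<A>" and \<B>: "|\<B>| <o r" "centered \<B>"
    and E: "|E| <o r" "\<And>e. e \<in> E \<Longrightarrow> mono (e :: nat \<Rightarrow> nat)"
    and \<delta>: "mono \<delta>" "\<And>n. n < \<delta> n"
  obtains x y where "infinite x" "infinite y"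
    "centered (\<A> \<union> gaps x ` E)" "centered (\<B> \<union> gaps y ` E)"
    "\<And>n. {n..<\<delta> n} \<subseteq> x \<or> {n..<\<delta> n} \<subseteq> y"
proof -
  let ?I = "\<lambda>\<A>. Inter ` {S. S \<subseteq> \<A> \<and> finite S}"
  let ?E = "(\<lambda>T n. \<Sum>e\<in>T. e n) ` {T. T \<subseteq> E \<and> finite T}"
  have H: "|?I \<A> \<union> ?I \<B>| <o r"
    by (intro small_Un small_image small_finite_subsets \<A>(1) \<B>(1))
  have H': "infinite A" if "A \<in> ?I \<A> \<union> ?I \<B>" for A
    using that \<A>(2) \<B>(2) by (auto simp: centered_def)
  have E': "|?E| <o r" by (intro small_image small_finite_subsets E(1))
  have E'': "mono e" if "e \<in> ?E" for e
    using that E(2) by (auto intro!: monoI sum_mono dest!: subsetD dest: monoD)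
  have centered_Un: "centered (\<C> \<union> gaps x ` E)"
    if gaps: "\<And>A e. A \<in> ?I \<C> \<Longrightarrow> e \<in> ?E \<Longrightarrow> infinite (A \<inter> gaps x e)" for \<C> x
    unfolding centered_def
  proof (intro allI impI)
    fix S assume S: "finite S" "S \<subseteq> \<C> \<union> gaps x ` E"
    then have "finite (S - \<C>)" "S - \<C> \<subseteq> gaps x ` E" by auto
    then obtain T where T: "T \<subseteq> E" "finite T" "S - \<C> = gaps x ` T"
      by (rule finite_subset_image[THEN exE]) blast
    let ?e = "\<lambda>n. \<Sum>e\<in>T. e n"
    have le: "e n \<le> ?e n" if "e \<in> T" for e n
      using that T(2) by (intro member_le_sum) auto
    have sub: "gaps x ?e \<subseteq> gaps x e" if "e \<in> T" for e
    proof
      fix m assume "m \<in> gaps x ?e"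
      moreover have "{m..<e m} \<subseteq> {m..<?e m}" using le[OF that, of m] by auto
      ultimately show "m \<in> gaps x e" unfolding gaps_def by blast
    qed
    have "\<Inter>(S \<inter> \<C>) \<inter> gaps x ?e \<subseteq> \<Inter>S"
    proof (intro subsetI InterI)
      fix m B assume m: "m \<in> \<Inter>(S \<inter> \<C>) \<inter> gaps x ?e" and B: "B \<in> S"
      show "m \<in> B"
      proof (cases "B \<in> \<C>")
        case True
        then show ?thesis using m B by blast
      next
        case False
        then have "B \<in> gaps x ` T" using B T(3) by blast
        then show ?thesis using sub m by blast
      qed
    qed
    moreover have "infinite (\<Inter>(S \<inter> \<C>) \<inter> gaps x ?e)"
      by (rule gaps) (use S T in auto)
    ultimately show "infinite (\<Inter>S)" by (rule infinite_super)
  qed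
  obtain x y where xy: "infinite x" "infinite y"
    and g: "\<And>A e. A \<in> ?I \<A> \<union> ?I \<B> \<Longrightarrow> e \<in> ?E \<Longrightarrow> infinite (A \<inter> gaps x e) \<and> infinite (A \<inter> gaps y e)"
    and c: "\<And>n. {n..<\<delta> n} \<subseteq> x \<or> {n..<\<delta> n} \<subseteq> y"
    by (rule two_sets_with_gaps[where H = "?I \<A> \<union> ?I \<B>" and E = ?E, OF H H' E' E'' \<delta>]) blast+
  show thesis
  proof (rule that[OF xy])
    show "centered (\<A> \<union> gaps x ` E)" "centered (\<B> \<union> gaps y ` E)"
      using g by (intro centered_Un; blast)+
  qed (rule c)
qed

end

section \<open>Recursive construction of the two sequences of sets\<close>

definition gap_family :: "'k rel \<Rightarrow> ('k \<Rightarrow> nat \<Rightarrow> nat) \<Rightarrow> ('k \<Rightarrow> nat set) \<Rightarrow> 'k set \<Rightarrow> nat set set" where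
  "gap_family r \<rho> x C = (\<Union>c\<in>C. (\<lambda>b. gaps (x c) (\<rho> b)) ` under r c)"

lemma gap_family_cong:
  "(\<And>c. c \<in> C \<Longrightarrow> x c = y c) \<Longrightarrow> gap_family r \<rho> x C = gap_family r \<rho> y C"
  by (simp add: gap_family_def)

context regular_uncountable
begin

lemma under_mono: "(b, c) \<in> r \<Longrightarrow> under r b \<subseteq> under r c"
  unfolding under_def by (intro subsetI) (simp, rule trans_r)

lemma small_gap_family: "|gap_family r \<rho> x (underS r c)| <o r"
  unfolding gap_family_def by (intro small_UN small_image small_underS small_under)

lemma gap_family_under:
  assumes "c \<in> Field r"
  shows "gap_family r \<rho> x (under r c) =
    gap_family r \<rho> x (underS r c) \<union> gaps (x c) ` \<rho> ` under r c"
proof -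
  have "under r c = underS r c \<union> {c}"
    using refl_r[OF assms] by (auto simp: under_def underS_def)
  then have "gap_family r \<rho> x (under r c) = gap_family r \<rho> x (underS r c \<union> {c})" by simp
  also have "\<dots> = gap_family r \<rho> x (underS r c) \<union> gaps (x c) ` \<rho> ` under r c"
    unfolding gap_family_def image_image by auto
  finally show ?thesis .
qed

text \<open>A finite subfamily involves finitely many indices and so already lies in the family up
  to the largest of them. This carries centeredness through limits.\<close>

lemma centered_gap_family:
  assumes C: "C \<subseteq> Field r" and cen: "\<And>c. c \<in> C \<Longrightarrow> centered (gap_family r \<rho> x (under r c))"
  shows "centered (gap_family r \<rho> x C)"
  unfolding centered_def
proof (intro allI impI)
  fix S assume S: "finite S" "S \<subseteq> gap_family r \<rho> x C"
  from S have "S = {} \<or> (\<exists>c\<in>C. S \<subseteq> gap_family r \<rho> x (under r c))"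
  proof (induction S)
    case (insert g S)
    have "g \<in> gap_family r \<rho> x C" using insert.prems by simp
    then obtain c where c: "c \<in> C" "g \<in> (\<lambda>b. gaps (x c) (\<rho> b)) ` under r c"
      unfolding gap_family_def by (elim UN_E)
    have g: "g \<in> gap_family r \<rho> x (under r d)" if "(c, d) \<in> r" for d
      unfolding gap_family_def
    proof (rule UN_I[where a = c])
      show "c \<in> under r d" using that by (simp add: under_def)
    qed (rule c(2))
    have c': "c \<in> Field r" using c(1) C by auto
    show ?case
    proof (cases "S = {}")
      case True
      then show ?thesis using g[OF refl_r[OF c']] c(1) by auto
    next
      case False
      then obtain d where d: "d \<in> C" "S \<subseteq> gap_family r \<rho> x (under r d)"
        using insert.IH insert.prems by auto
      have d': "d \<in> Field r" using d(1) C by auto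
      from linear_r[OF c' d'] show ?thesis
      proof
        assume "(c, d) \<in> r"
        then show ?thesis using d g by auto
      next
        assume dc: "(d, c) \<in> r"
        have "gap_family r \<rho> x (under r d) \<subseteq> gap_family r \<rho> x (under r c)"
          unfolding gap_family_def by (intro UN_mono under_mono[OF dc] subset_refl)
        then have "S \<subseteq> gap_family r \<rho> x (under r c)" using d(2) by (rule subset_trans[rotated])
        then show ?thesis using c(1) g[OF refl_r[OF c']] by auto
      qed
    qed
  qed simp
  then show "infinite (\<Inter>S)"
  proof
    assume "\<exists>c\<in>C. S \<subseteq> gap_family r \<rho> x (under r c)"
    then obtain c where c: "c \<in> C" "S \<subseteq> gap_family r \<rho> x (under r c)" by (elim bexE)
    show ?thesis using cen[OF c(1)] c(2) S(1) unfolding centered_def by simp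
  qed simp
qed

end

context d_le_r
begin

text \<open>Recursion along r. At stage c there are fewer than r earlier requirements, so
  \<open>centered_extension\<close> applies with \<delta> = \<rho> c and with gaps requested for all
  \<rho> b, b up to c. Thus a fixed \<rho> b is respected by all sets from index b on.\<close>

lemma two_sequences_with_gaps:
  fixes \<rho> :: "'k \<Rightarrow> nat \<Rightarrow> nat"
  assumes \<rho>: "\<And>b. mono (\<rho> b)" "\<And>b n. n < \<rho> b n"
  obtains x y where
    "\<And>c. c \<in> Field r \<Longrightarrow> infinite (x c) \<and> infinite (y c)"
    "\<And>c n. c \<in> Field r \<Longrightarrow> {n..<\<rho> c n} \<subseteq> x c \<or> {n..<\<rho> c n} \<subseteq> y c"
    "centered (gap_family r \<rho> x (Field r))" "centered (gap_family r \<rho> y (Field r))"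
proof -
  \<comment> \<open>Vacuous outside the field of r; it refers to \<open>f\<close> only at indices
    below c, as the choice principle requires.\<close>
  define P where "P f c v \<longleftrightarrow> (c \<in> Field r \<longrightarrow> infinite (fst v) \<and> infinite (snd v) \<and>
     (\<forall>n. {n..<\<rho> c n} \<subseteq> fst v \<or> {n..<\<rho> c n} \<subseteq> snd v) \<and>
     centered (gap_family r \<rho> (fst \<circ> f) (underS r c) \<union> gaps (fst v) ` \<rho> ` under r c) \<and>
     centered (gap_family r \<rho> (snd \<circ> f) (underS r c) \<union> gaps (snd v) ` \<rho> ` under r c))"
    for f :: "'k \<Rightarrow> nat set \<times> nat set" and c v
  have "\<exists>f. \<forall>c. P f c (f c)"
  proof (rule dependent_wf_choice)
    show "wf (r - Id)" using Well_order by (simp add: well_order_on_def)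
  next
    fix f g :: "'k \<Rightarrow> nat set \<times> nat set" and c v
    assume eq: "\<And>z. (z, c) \<in> r - Id \<Longrightarrow> f z = g z"
    have "(\<pi> \<circ> f) z = (\<pi> \<circ> g) z" if "z \<in> underS r c" for z and \<pi> :: "nat set \<times> nat set \<Rightarrow> nat set"
      using eq[of z] that by (simp add: underS_def)
    then have "gap_family r \<rho> (\<pi> \<circ> f) (underS r c) = gap_family r \<rho> (\<pi> \<circ> g) (underS r c)"
      for \<pi> :: "nat set \<times> nat set \<Rightarrow> nat set"
      by (rule gap_family_cong)
    then show "P f c v = P g c v" unfolding P_def by simp
  next
    fix c f assume IH: "\<And>b. (b, c) \<in> r - Id \<Longrightarrow> P f b (f b)"
    show "\<exists>v. P f c v"
    proof (cases "c \<in> Field r")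
      case True
      have sub: "underS r c \<subseteq> Field r" by (auto simp: underS_def Field_def)
      have "centered (gap_family r \<rho> (fst \<circ> f) (under r b))"
           "centered (gap_family r \<rho> (snd \<circ> f) (under r b))" if "b \<in> underS r c" for b
      proof -
        have "b \<in> Field r" using that sub by auto
        then show "centered (gap_family r \<rho> (fst \<circ> f) (under r b))"
           "centered (gap_family r \<rho> (snd \<circ> f) (under r b))"
          using IH[of b] that by (simp_all add: P_def underS_def gap_family_under)
      qed
      \<comment> \<open>Everything built before c is a union over initial segments, so limit and
        successor stages need no distinction.\<close>
      then have cen: "centered (gap_family r \<rho> (fst \<circ> f) (underS r c))"
        "centered (gap_family r \<rho> (snd \<circ> f) (underS r c))"
        by (auto intro: centered_gap_family[OF sub])
      have E: "|\<rho> ` under r c| <o r" by (intro small_image small_under)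
      have E': "mono e" if "e \<in> \<rho> ` under r c" for e using that \<rho>(1) by auto
      obtain x y where "infinite x" "infinite y"
        "centered (gap_family r \<rho> (fst \<circ> f) (underS r c) \<union> gaps x ` \<rho> ` under r c)"
        "centered (gap_family r \<rho> (snd \<circ> f) (underS r c) \<union> gaps y ` \<rho> ` under r c)"
        "\<And>n. {n..<\<rho> c n} \<subseteq> x \<or> {n..<\<rho> c n} \<subseteq> y"
        by (rule centered_extension[OF small_gap_family cen(1) small_gap_family cen(2) E E'
            \<rho>(1)[of c] \<rho>(2)[of _ c]]) blast+
      then have "P f c (x, y)" unfolding P_def by simp
      then show ?thesis ..
    qed (simp add: P_def)
  qed
  then obtain f where f: "\<And>c. P f c (f c)" by blast
  show thesis
  proof (rule that[of "fst \<circ> f" "snd \<circ> f"])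
    fix c assume c: "c \<in> Field r"
    show "infinite ((fst \<circ> f) c) \<and> infinite ((snd \<circ> f) c)"
      using f[of c] c by (simp add: P_def)
    show "{n..<\<rho> c n} \<subseteq> (fst \<circ> f) c \<or> {n..<\<rho> c n} \<subseteq> (snd \<circ> f) c" for n
      using f[of c] c by (simp add: P_def)
  next
    have "centered (gap_family r \<rho> (fst \<circ> f) (under r c))"
         "centered (gap_family r \<rho> (snd \<circ> f) (under r c))" if "c \<in> Field r" for c
      using f[of c] that by (simp_all add: P_def gap_family_under)
    then show "centered (gap_family r \<rho> (fst \<circ> f) (Field r))"
      "centered (gap_family r \<rho> (snd \<circ> f) (Field r))"
      by (simp_all add: centered_gap_family)
  qed
qed

end

text \<open>Finite intersections are infinite, hence nonempty, so the generated filter is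
  proper.\<close>

lemma centered_filter:
  assumes "centered \<A>"
  obtains F where "F \<noteq> bot" "\<And>A. A \<in> \<A> \<Longrightarrow> eventually (\<lambda>n. n \<in> A) F"
proof
  show "(INF A\<in>\<A>. principal A) \<noteq> bot"
  proof (rule INF_filter_not_bot)
    fix S assume S: "S \<subseteq> \<A>" "finite S"
    have "infinite (\<Inter>S)" using assms S unfolding centered_def by simp
    then have "\<Inter>S \<noteq> {}" by (intro notI) simp
    moreover have "(INF A\<in>S. principal A) = principal (\<Inter>S)"
      using INF_principal_finite[OF S(2), of id] by simp
    ultimately show "(INF A\<in>S. principal A) \<noteq> bot" by (simp add: principal_eq_bot_iff)
  qed
  show "eventually (\<lambda>n. n \<in> A) (INF A\<in>\<A>. principal A)" if "A \<in> \<A>" for A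
  proof -
    have "eventually (\<lambda>n. n \<in> A) (principal A)" by (simp add: eventually_principal)
    then show ?thesis by (rule filter_leD[OF INF_lower[OF that, of principal]])
  qed
qed

section \<open>The dominating and reaping numbers in terms of functions\<close>

lemma enumerate_range_strict_mono:
  assumes f: "strict_mono (f :: nat \<Rightarrow> nat)"
  shows "enumerate (range f) n = f n"
proof -
  have inf: "infinite (range f)"
    by (intro range_inj_infinite strict_mono_imp_inj_on f)
  show ?thesis
  proof (induction n)
    case 0
    show ?case unfolding enumerate_0
      by (rule Least_equality) (auto simp: strict_mono_less_eq[OF f])
  next
    case (Suc n)
    show ?case unfolding enumerate_Suc''[OF inf] Suc
      by (rule Least_equality) (auto simp: strict_mono_less_eq[OF f] strict_mono_less[OF f])
  qed
qed

text \<open>The sum makes it nondecreasing and above \<open>f\<close>, the summand n makes it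
  strictly increasing, and the 1 makes it positive, so that its range lies in
  \<open>inf_sets\<close>.\<close>

definition increasing_majorant :: "(nat \<Rightarrow> nat) \<Rightarrow> nat \<Rightarrow> nat" where
  "increasing_majorant f n = (\<Sum>i\<le>n. f i) + n + 1"

lemma increasing_majorant:
  "f n \<le> increasing_majorant f n" "strict_mono (increasing_majorant f)"
  "range (increasing_majorant f) \<in> inf_sets"
proof -
  show "f n \<le> increasing_majorant f n"
  proof -
    have "f n \<le> (\<Sum>i\<le>n. f i)" by (rule member_le_sum) auto
    then show ?thesis by (simp add: increasing_majorant_def)
  qed
  show sm: "strict_mono (increasing_majorant f)"
    by (simp add: strict_mono_Suc_iff increasing_majorant_def)
  have "range (increasing_majorant f) \<subseteq> {1..}" by (auto simp: increasing_majorant_def)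
  moreover have "infinite (range (increasing_majorant f))"
    by (intro range_inj_infinite strict_mono_imp_inj_on sm)
  ultimately show "range (increasing_majorant f) \<in> inf_sets" by (simp add: inf_sets_def)
qed

lemma dominating_eventually_le:
  assumes "dominating D"
  obtains y N where "y \<in> D" "\<And>n. N \<le> n \<Longrightarrow> f n \<le> enumerate y n"
proof -
  let ?g = "increasing_majorant f"
  obtain y where y: "y \<in> D" "range ?g \<le>\<^sup>* y"
    using assms increasing_majorant(3)[of f] unfolding dominating_def by blast
  have "finite {n. enumerate y n < ?g n}"
    using y(2) unfolding le_star_def enumerate_range_strict_mono[OF increasing_majorant(2)] .
  then obtain N where N: "\<forall>n\<in>{n. enumerate y n < ?g n}. n < N"
    unfolding finite_nat_set_iff_bounded by (elim exE)
  have "f n \<le> enumerate y n" if "N \<le> n" for n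
  proof -
    have "\<not> enumerate y n < ?g n" using N that by auto
    then show ?thesis using increasing_majorant(1)[of f n] by simp
  qed
  then show thesis by (rule that[OF y(1)])
qed

text \<open>Conversely to \<open>dominating_eventually_le\<close>, this passes from functions to
  sets; a larger function only dominates more.\<close>

lemma dominating_range_majorants:
  fixes Q :: "(nat \<Rightarrow> nat) set"
  assumes Q: "\<And>h. \<exists>q\<in>Q. finite {k. q k < h k}"
  shows "dominating ((\<lambda>q. range (increasing_majorant q)) ` Q)"
  unfolding dominating_def
proof (intro conjI ballI)
  show "(\<lambda>q. range (increasing_majorant q)) ` Q \<subseteq> inf_sets"
    using increasing_majorant(3) by auto
  fix x
  obtain q where q: "q \<in> Q" "finite {k. q k < enumerate x k}" using Q[of "enumerate x"] by blast
  have "{n. increasing_majorant q n < enumerate x n} \<subseteq> {k. q k < enumerate x k}"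
    using increasing_majorant(1)[of q] by (auto intro: le_less_trans)
  then have "x \<le>\<^sup>* range (increasing_majorant q)"
    unfolding le_star_def enumerate_range_strict_mono[OF increasing_majorant(2)]
    using q(2) by (rule finite_subset)
  then show "\<exists>y\<in>(\<lambda>q. range (increasing_majorant q)) ` Q. x \<le>\<^sup>* y" using q(1) by blast
qed

text \<open>Diagonal argument: given an enumeration \<open>y\<close> of \<open>D\<close>, the
  function n \<mapsto> 1 + (sum of the n-th elements of y 0, ..., y n) exceeds each y i from i
  on.\<close>

lemma dominating_uncountable:
  assumes D: "dominating D"
  shows "|UNIV :: nat set| <o |D|"
proof (rule ccontr)
  assume "\<not> |UNIV :: nat set| <o |D|"
  then have "|D| \<le>o |UNIV :: nat set|"
    by (simp only: not_ordLess_iff_ordLeq[OF card_of_Well_order card_of_Well_order])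
  moreover have "D \<noteq> {}"
  proof -
    obtain x where "x \<in> D" by (rule dominating_eventually_le[OF D, of "\<lambda>_. 0"])
    then show ?thesis by auto
  qed
  ultimately obtain y :: "nat \<Rightarrow> nat set" where y: "D = y ` UNIV"
    using card_of_ordLeq2[of D "UNIV :: nat set"] by auto
  obtain x N where x: "x \<in> D" "\<And>n. N \<le> n \<Longrightarrow> Suc (\<Sum>i\<le>n. enumerate (y i) n) \<le> enumerate x n"
    by (rule dominating_eventually_le[OF D, of "\<lambda>n. Suc (\<Sum>i\<le>n. enumerate (y i) n)"]) blast
  have "x \<in> range y" using x(1) by (simp only: y)
  then obtain i where i: "x = y i" by (rule rangeE)
  define k where "k = max i N"
  have k: "i \<le> k" "N \<le> k" by (simp_all add: k_def)
  have "enumerate (y i) k \<le> (\<Sum>i\<le>k. enumerate (y i) k)"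
    by (rule member_le_sum[of i "{..k}" "\<lambda>j. enumerate (y j) k"]) (simp_all add: k)
  also have "\<dots> < enumerate (y i) k"
    using x(2)[OF k(2)] unfolding i by (rule Suc_le_lessD)
  finally show False by simp
qed

lemma dominating_number_witness: obtains D where "dominating D" "\<dd> = |D|"
proof -
  have "\<dd> \<in> card_of ` {D. dominating D}"
    unfolding dominating_number_def by (rule min_card(1)[OF dominating_exists])
  then obtain D where "D \<in> {D. dominating D}" "\<dd> = |D|" by (elim imageE)
  then show thesis using that by simp
qed

lemma uncountable_d: "|UNIV :: nat set| <o \<dd>"
proof -
  obtain D where D: "dominating D" "\<dd> = |D|" by (rule dominating_number_witness)
  show ?thesis unfolding D(2) by (rule dominating_uncountable[OF D(1)])
qed

lemma Cinfinite_d: "Cinfinite \<dd>"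
proof -
  obtain D where D: "dominating D" "\<dd> = |D|" by (rule dominating_number_witness)
  have inf: "infinite D"
    unfolding infinite_iff_card_of_nat using ordLess_imp_ordLeq[OF uncountable_d] unfolding D(2) .
  show ?thesis
    unfolding D(2) cinfinite_def using inf card_of_Card_order[of D] by (simp only: Field_card_of simp_thms)
qed

lemma undominated_d:
  fixes Q :: "(nat \<Rightarrow> nat) set"
  assumes "|Q| <o \<dd>"
  shows "\<exists>h. \<forall>q\<in>Q. infinite {k. q k < h k}"
proof (rule ccontr)
  assume neg: "\<not> ?thesis"
  have "\<exists>q\<in>Q. finite {k. q k < h k}" for h using neg by simp
  then have "dominating ((\<lambda>q. range (increasing_majorant q)) ` Q)"
    by (rule dominating_range_majorants)
  then have "\<dd> \<le>o |(\<lambda>q. range (increasing_majorant q)) ` Q|"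
    unfolding dominating_number_def by (intro min_card(2) dominating_exists) simp
  also have "|(\<lambda>q. range (increasing_majorant q)) ` Q| \<le>o |Q|" by (rule card_of_image)
  finally show False using not_ordLess_ordLeq[OF assms] by simp
qed

lemma reaped_if_small:
  assumes "A \<subseteq> inf_sets" "|A| <o \<rr>"
  shows "\<exists>R\<in>inf_sets. reaps R A"
proof (rule ccontr)
  assume "\<not> ?thesis"
  then have "unreaped A" using assms(1) by (simp add: unreaped_def)
  then have "\<rr> \<le>o |A|"
    unfolding reaping_number_def by (intro min_card(2) unreaped_exists) simp
  then show False using not_ordLess_ordLeq[OF assms(2)] by simp
qed

lemma d_le_r_dominating_number:
  assumes "\<dd> \<le>o \<rr>" "regularCard \<dd>"
  shows "d_le_r \<dd>"
proof
  show "Cinfinite \<dd>" by (rule Cinfinite_d)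
  show "regularCard \<dd>" by fact
  show "|UNIV :: nat set| <o \<dd>" by (rule uncountable_d)
  show "\<exists>h. \<forall>q\<in>Q. infinite {k. q k < h k}" if "|Q| <o \<dd>" for Q :: "(nat \<Rightarrow> nat) set"
    using that by (rule undominated_d)
  show "\<exists>R\<in>inf_sets. reaps R A" if "A \<subseteq> inf_sets" "|A| <o \<dd>" for A
    using that(1) ordLess_ordLeq_trans[OF that(2) assms(1)] by (rule reaped_if_small)
qed

text \<open>An infinite dominating family of size \<open>\<dd>\<close> remains of size \<open>\<dd>\<close> when its members are
  shifted by all constants, which turns eventual domination into domination everywhere.\<close>

lemma everywhere_dominating:
  obtains \<rho> :: "nat set \<Rightarrow> nat \<Rightarrow> nat" where "\<And>b. mono (\<rho> b)" "\<And>b n. n < \<rho> b n"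
    "\<And>f. \<exists>b\<in>Field \<dd>. \<forall>n. f n \<le> \<rho> b n"
proof -
  obtain D where D: "dominating D" "\<dd> = |D|" by (rule dominating_number_witness)
  have F: "Field \<dd> = D" unfolding D(2) by (rule Field_card_of)
  have inf: "infinite D" using Cinfinite_d F by (simp add: cinfinite_def)
  have "|D \<times> (UNIV :: nat set)| =o |D|"
    using card_of_Times_infinite_simps(1)[OF inf UNIV_not_empty] inf[unfolded infinite_iff_card_of_nat]
    by blast
  from ordIso_symmetric[OF this] obtain \<tau> where \<tau>: "bij_betw \<tau> D (D \<times> (UNIV :: nat set))"
    unfolding card_of_ordIso[symmetric] by (elim exE)
  \<comment> \<open>The second component of \<open>\<tau> b\<close> is the shift that repairs
    finitely many values; the final 1 makes \<rho> b n exceed n. Outside \<open>D\<close> the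
    identity keeps both properties for every b.\<close>
  define \<rho> where "\<rho> b n = (if b \<in> D then enumerate (fst (\<tau> b)) n + snd (\<tau> b) else n) + 1" for b n
  have inf_\<tau>: "infinite (fst (\<tau> b))" if "b \<in> D" for b
  proof -
    have "\<tau> b \<in> D \<times> UNIV" using bij_betwE[OF \<tau>] that by blast
    then show ?thesis using D(1) by (auto simp: dominating_def inf_sets_def)
  qed
  show thesis
  proof
    show "mono (\<rho> b)" for b
    proof (rule monoI)
      fix i j :: nat assume "i \<le> j"
      then show "\<rho> b i \<le> \<rho> b j"
        using enumerate_mono_le_iff[OF inf_\<tau>[of b], of i j] by (simp add: \<rho>_def)
    qed
    show "n < \<rho> b n" for b n
      using le_enumerate[OF inf_\<tau>[of b], of n] by (cases "b \<in> D") (simp_all add: \<rho>_def)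
    fix f :: "nat \<Rightarrow> nat"
    obtain y N where y: "y \<in> D" "\<And>n. N \<le> n \<Longrightarrow> f n \<le> enumerate y n"
      by (rule dominating_eventually_le[where f = f, OF D(1)]) blast
    \<comment> \<open>The shift is the sum of the values of \<open>f\<close> below N, where
      \<open>y\<close> may fail to dominate.\<close>
    have "(y, \<Sum>n<N. f n) \<in> \<tau> ` D" using bij_betw_imp_surj_on[OF \<tau>] y(1) by simp
    then obtain b where b: "b \<in> D" "\<tau> b = (y, \<Sum>n<N. f n)" by auto
    have "f n \<le> \<rho> b n" for n
    proof (cases "n < N")
      case True
      then have "f n \<le> (\<Sum>n<N. f n)" using member_le_sum[of n "{..<N}" f] by simp
      then show ?thesis using b by (simp add: \<rho>_def)
    next
      case False
      then show ?thesis using y(2)[of n] b by (simp add: \<rho>_def)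
    qed
    then show "\<exists>b\<in>Field \<dd>. \<forall>n. f n \<le> \<rho> b n" using b(1) F by blast
  qed
qed

text \<open>The filter is generated by the gap sets. It remains to verify the two smallness
  hypotheses of \<open>Menger_along_prod\<close>.\<close>

lemma (in d_le_r) Menger_along_filter:
  fixes \<rho> :: "'k \<Rightarrow> nat \<Rightarrow> nat" and x :: "'k \<Rightarrow> nat set"
  assumes dom: "\<And>f :: nat \<Rightarrow> nat. \<exists>b\<in>Field r. \<forall>n. f n \<le> \<rho> b n"
    and inf: "\<And>c. c \<in> Field r \<Longrightarrow> infinite (x c)"
    and cen: "centered (gap_family r \<rho> x (Field r))"
  obtains F where "F \<noteq> bot"
    "\<And>T :: 'a topology. Menger_along F T \<Longrightarrow>
      Menger_along F (prod_topology T (top_of_set (ternary ` ({a. finite a} \<union> x ` Field r))))"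
proof -
  obtain F where F: "F \<noteq> bot"
    and fam: "\<And>A. A \<in> gap_family r \<rho> x (Field r) \<Longrightarrow> eventually (\<lambda>n. n \<in> A) F"
    by (rule centered_filter[OF cen]) blast
  have ev: "eventually (\<lambda>m. x c \<inter> {m..<\<rho> b m} = {}) F" if "c \<in> Field r" "(b, c) \<in> r" for b c
  proof -
    have "gaps (x c) (\<rho> b) \<in> (\<lambda>b. gaps (x c) (\<rho> b)) ` under r c"
      using that(2) by (simp add: under_def)
    then have "gaps (x c) (\<rho> b) \<in> gap_family r \<rho> x (Field r)"
      unfolding gap_family_def by (rule UN_I[OF that(1)])
    from fam[OF this] show ?thesis by (simp add: gaps_def)
  qed
  let ?Z = "{a. finite a} \<union> x ` Field r"
  have gaps: "|{z\<in>?Z. \<not> eventually (\<lambda>m. z \<inter> {m..<g m} = {}) F}| <o r" for g :: "nat \<Rightarrow> nat"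
  proof -
    obtain b where b: "b \<in> Field r" "\<forall>n. g n \<le> \<rho> b n" using dom[of g] by (elim bexE)
    \<comment> \<open>If \<rho> b bounds \<open>g\<close>, all sets x c with c from b on have the
      required gaps; only earlier indices and the countably many finite sets can fail.\<close>
    have sub: "{z\<in>?Z. \<not> eventually (\<lambda>m. z \<inter> {m..<g m} = {}) F} \<subseteq> {a. finite a} \<union> x ` underS r b"
    proof
      fix z assume z: "z \<in> {z\<in>?Z. \<not> eventually (\<lambda>m. z \<inter> {m..<g m} = {}) F}"
      show "z \<in> {a. finite a} \<union> x ` underS r b"
      proof (cases "finite z")
        case False
        then obtain c where c: "c \<in> Field r" "z = x c" using z by auto
        have "(b, c) \<notin> r"
        proof
          assume "(b, c) \<in> r"
          from ev[OF c(1) this] have "eventually (\<lambda>m. x c \<inter> {m..<g m} = {}) F"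
          proof eventually_elim
            case (elim m)
            have "{m..<g m} \<subseteq> {m..<\<rho> b m}" using b(2)[rule_format, of m] by auto
            then show ?case using elim by blast
          qed
          then show False using z c(2) by simp
        qed
        then have "c \<in> underS r b"
          using linear_r[OF b(1) c(1)] refl_r[OF c(1)] by (auto simp: underS_def)
        then show ?thesis using c(2) by simp
      qed simp
    qed
    have "countable {a :: nat set. finite a}"
      using countable_Collect_finite by simp
    then have "|{a :: nat set. finite a} \<union> x ` underS r b| <o r"
      by (intro small_Un small_countable small_image small_underS)
    then show ?thesis using sub by (rule small_subset)
  qed
  have bdd: "\<exists>g. \<forall>f\<in>I. eventually (\<lambda>m. f m \<le> g m) F" if I: "|I| <o r" for I :: "(nat \<Rightarrow> nat) set"
  proof -
    have "\<forall>f. \<exists>b\<in>Field r. \<forall>n. f n \<le> \<rho> b n" using dom by simp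
    then obtain b where b: "\<forall>f. b f \<in> Field r \<and> (\<forall>n. f n \<le> \<rho> (b f) n)"
      unfolding Bex_def by (rule choice[THEN exE])
    obtain c where c: "c \<in> Field r" "\<And>d. d \<in> b ` I \<Longrightarrow> (d, c) \<in> r"
    proof (rule small_bounded[of "b ` I"])
      show "|b ` I| <o r" by (rule small_image[OF I])
      show "b ` I \<subseteq> Field r" using b by auto
    qed blast
    \<comment> \<open>Where x c omits [m, \<rho> b m), its next element from m on is at least \<rho>
      b m. With c above all the indices chosen for \<open>I\<close>, this one function bounds all of
      \<open>I\<close>.\<close>
    have "eventually (\<lambda>m. f m \<le> next_in (x c) m) F" if f: "f \<in> I" for f
      using ev[OF c(1) c(2)[OF imageI[OF f]]]
    proof eventually_elim
      case (elim m)
      have "next_in (x c) m \<in> x c" "m \<le> next_in (x c) m"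
        using next_in[OF inf[OF c(1)]] by simp_all
      then have "\<not> next_in (x c) m < \<rho> (b f) m" using elim by auto
      then show ?case using b by (meson le_trans not_less)
    qed
    then show ?thesis by (intro exI[of _ "next_in (x c)"] ballI)
  qed
  show thesis
  proof (rule that[OF F])
    fix T :: "'a topology" assume "Menger_along F T"
    then show "Menger_along F (prod_topology T (top_of_set (ternary ` ?Z)))"
      by (rule Menger_along_prod[where r = r]) (simp, rule gaps, rule bdd)
  qed
qed

lemma Menger_finite_powers_and_Scheepers:
  fixes X :: "real set"
  assumes F: "F \<noteq> bot"
    and prod: "\<And>T :: (nat \<Rightarrow> real) topology. Menger_along F T \<Longrightarrow>
      Menger_along F (prod_topology T (top_of_set X))"
  shows "Menger (finite_power (top_of_set X) n)" "Scheepers (top_of_set X)"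
proof -
  have power: "Menger_along F (finite_power (top_of_set X) n)" for n
    by (rule Menger_along_finite_power[OF prod])
  show "Menger (finite_power (top_of_set X) n)"
    by (rule Scheepers_imp_Menger[OF Menger_along_imp_Scheepers[OF power Lindelof_space_finite_power F]])
  have "Menger_along F (top_of_set X)"
  \<comment> \<open>\<open>X\<close> is obtained from its product with the one-point zeroth power,
    because \<open>prod\<close> speaks only of products.\<close>
  proof (rule Menger_along_image[OF prod[OF power[of 0]]])
    show "continuous_map (prod_topology (finite_power (top_of_set X) 0) (top_of_set X)) (top_of_set X) snd"
      by (rule continuous_map_snd)
    show "snd ` topspace (prod_topology (finite_power (top_of_set X) 0) (top_of_set X)) = topspace (top_of_set X)"
      by (simp add: finite_power_def)
  qed
  then show "Scheepers (top_of_set X)"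
    by (rule Menger_along_imp_Scheepers[OF _ Lindelof_space_top_of_set F])
qed

section \<open>Covers defeating the union and the product\<close>

lemma finite_subset_range_chain:
  fixes U :: "nat \<Rightarrow> 'a set"
  assumes "mono U" "finite \<F>" "\<F> \<subseteq> range U"
  obtains k where "\<Union>\<F> \<subseteq> U k"
proof -
  obtain K where K: "finite K" "\<F> = U ` K"
    using finite_subset_image[OF assms(2,3)] by blast
  then obtain k where k: "\<forall>i\<in>K. i < k" unfolding finite_nat_set_iff_bounded by blast
  have "U i \<subseteq> U k" if "i \<in> K" for i
    using k that by (intro monoD[OF assms(1)]) (simp add: less_imp_le)
  then show thesis using that K(2) by (metis UN_least)
qed

lemma open_cover_range:
  assumes "\<And>k. openin X (U k)" "topspace X \<subseteq> (\<Union>k. U k)"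
  shows "open_cover X (range U)"
proof -
  have "(\<Union>k. U k) \<subseteq> topspace X" using openin_subset[OF assms(1)] by (rule UN_least)
  then show ?thesis using assms by (auto simp: open_cover_def)
qed

text \<open>A finite subfamily of an increasing sequence lies below one member, so a selection
  amounts to a function; similarly for \<open>Scheepers_increasing\<close>.\<close>

lemma Menger_increasing:
  fixes U :: "nat \<Rightarrow> nat \<Rightarrow> 'a set"
  assumes M: "Menger X" and U: "\<And>n k. openin X (U n k)" "\<And>n. mono (U n)"
    "\<And>n. topspace X \<subseteq> (\<Union>k. U n k)"
  obtains f where "\<And>x. x \<in> topspace X \<Longrightarrow> \<exists>n. x \<in> U n (f n)"
proof -
  have "\<forall>n. open_cover X (range (U n))" by (intro allI open_cover_range U)
  from M[unfolded Menger_def, THEN spec, THEN mp, OF this]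
  obtain \<F> where \<F>: "\<forall>n. finite (\<F> n) \<and> \<F> n \<subseteq> range (U n)" "topspace X \<subseteq> \<Union>(\<Union>n. \<F> n)"
    by (elim exE conjE)
  have "\<forall>n. \<exists>k. \<Union>(\<F> n) \<subseteq> U n k"
  proof
    fix n
    obtain k where "\<Union>(\<F> n) \<subseteq> U n k"
      by (rule finite_subset_range_chain[OF U(2), of "\<F> n" n]) (use \<F>(1) in simp_all)
    then show "\<exists>k. \<Union>(\<F> n) \<subseteq> U n k" ..
  qed
  then obtain f where f: "\<forall>n. \<Union>(\<F> n) \<subseteq> U n (f n)" by (rule choice[THEN exE])
  show thesis
  proof (rule that)
    fix x assume "x \<in> topspace X"
    then obtain n where n: "x \<in> \<Union>(\<F> n)" using \<F>(2) by fast
    have "x \<in> U n (f n)" using f[rule_format, of n] n by (rule subsetD)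
    then show "\<exists>n. x \<in> U n (f n)" ..
  qed
qed

lemma Scheepers_increasing:
  fixes U :: "nat \<Rightarrow> nat \<Rightarrow> 'a set"
  assumes M: "Scheepers X" and U: "\<And>n k. openin X (U n k)" "\<And>n. mono (U n)"
    "\<And>n. topspace X \<subseteq> (\<Union>k. U n k)"
  obtains f where "\<And>S. finite S \<Longrightarrow> S \<subseteq> topspace X \<Longrightarrow> \<exists>n. S \<subseteq> U n (f n)"
proof -
  have "\<forall>n. open_cover X (range (U n))" by (intro allI open_cover_range U)
  from M[unfolded Scheepers_def, THEN spec, THEN mp, OF this]
  obtain \<F> where \<F>: "\<forall>n. finite (\<F> n) \<and> \<F> n \<subseteq> range (U n)"
    "\<forall>S. finite S \<and> S \<subseteq> topspace X \<longrightarrow> (\<exists>n. S \<subseteq> \<Union>(\<F> n))"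
    by (elim exE conjE)
  have "\<forall>n. \<exists>k. \<Union>(\<F> n) \<subseteq> U n k"
  proof
    fix n
    obtain k where "\<Union>(\<F> n) \<subseteq> U n k"
      by (rule finite_subset_range_chain[OF U(2), of "\<F> n" n]) (use \<F>(1) in simp_all)
    then show "\<exists>k. \<Union>(\<F> n) \<subseteq> U n k" ..
  qed
  then obtain f where f: "\<forall>n. \<Union>(\<F> n) \<subseteq> U n (f n)" by (rule choice[THEN exE])
  show thesis
  proof (rule that)
    fix S assume "finite S" "S \<subseteq> topspace X"
    then obtain n where n: "S \<subseteq> \<Union>(\<F> n)" using \<F>(2) by auto
    have "S \<subseteq> U n (f n)" using n f[rule_format, of n] by (rule subset_trans)
    then show "\<exists>n. S \<subseteq> U n (f n)" ..
  qed
qed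

text \<open>A selection \<open>f\<close> from these covers misses a point \<open>a\<close> of
  \<open>Z\<close> at stage n exactly when \<open>a\<close> contains all of [n, f n).\<close>

definition omitting :: "nat set set \<Rightarrow> nat \<Rightarrow> nat \<Rightarrow> real set" where
  "omitting Z n m = ternary ` (Z \<inter> {a. \<not> {n..<m} \<subseteq> a})"

lemma openin_omitting: "openin (top_of_set (ternary ` Z)) (omitting Z n m)"
  unfolding omitting_def
proof (rule openin_ternary_image[where m = m])
  fix a b assume a: "a \<in> {a. \<not> {n..<m} \<subseteq> a}" and eq: "a \<inter> {..<m} = b \<inter> {..<m}"
  then obtain i where "i \<in> {n..<m}" "i \<notin> a" by blast
  then have "i \<notin> b" using eq by auto
  then show "b \<in> {a. \<not> {n..<m} \<subseteq> a}" using \<open>i \<in> {n..<m}\<close> by blast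
qed

lemma mono_omitting: "mono (omitting Z n)"
proof (rule monoI)
  fix i j :: nat assume "i \<le> j"
  then have "{n..<i} \<subseteq> {n..<j}" by simp
  then show "omitting Z n i \<subseteq> omitting Z n j" unfolding omitting_def by blast
qed

lemma omitting_iff: "ternary a \<in> omitting Z n m \<longleftrightarrow> a \<in> Z \<and> \<not> {n..<m} \<subseteq> a"
  unfolding omitting_def by (simp add: inj_image_mem_iff[OF inj_ternary])

lemma omitting_covers:
  assumes "a \<in> Z" "infinite (- a)"
  obtains m where "\<And>k. m \<le> k \<Longrightarrow> ternary a \<in> omitting Z n k"
proof -
  obtain i where i: "n \<le> i" "i \<notin> a"
    using assms(2) unfolding infinite_nat_iff_unbounded_le by blast
  have "ternary a \<in> omitting Z n k" if "Suc i \<le> k" for k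
  proof -
    have "i \<in> {n..<k}" using i that by simp
    then show ?thesis using i(2) assms(1) unfolding omitting_iff by blast
  qed
  then show thesis by (rule that)
qed

context
  fixes Z Z' :: "nat set set"
  assumes coinfinite: "\<And>a. a \<in> Z \<union> Z' \<Longrightarrow> infinite (- a)"
    and intervals: "\<And>f :: nat \<Rightarrow> nat. \<exists>a\<in>Z. \<exists>b\<in>Z'. \<forall>n. {n..<f n} \<subseteq> a \<or> {n..<f n} \<subseteq> b"
begin

text \<open>For any selection, the pair from \<open>intervals\<close> is a two-point set never
  caught in one stage, since at each n one of its points is missed.\<close>

lemma union_not_Scheepers: "\<not> Scheepers (top_of_set (ternary ` Z \<union> ternary ` Z'))"
proof
  let ?X = "top_of_set (ternary ` (Z \<union> Z'))"
  assume "Scheepers (top_of_set (ternary ` Z \<union> ternary ` Z'))"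
  then have S: "Scheepers ?X" by (simp add: image_Un)
  have cov: "topspace ?X \<subseteq> (\<Union>m. omitting (Z \<union> Z') n m)" for n
  proof
    fix p assume "p \<in> topspace ?X"
    then obtain a where a: "a \<in> Z \<union> Z'" "p = ternary a" by auto
    obtain m where "\<And>k. m \<le> k \<Longrightarrow> ternary a \<in> omitting (Z \<union> Z') n k"
      by (rule omitting_covers[OF a(1) coinfinite[OF a(1)]]) blast
    then have "p \<in> omitting (Z \<union> Z') n m" using a(2) by simp
    then show "p \<in> (\<Union>m. omitting (Z \<union> Z') n m)" by (rule UN_I[OF UNIV_I])
  qed
  obtain f where f: "\<And>S. finite S \<Longrightarrow> S \<subseteq> topspace ?X \<Longrightarrow> \<exists>n. S \<subseteq> omitting (Z \<union> Z') n (f n)"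
    using Scheepers_increasing[where U = "omitting (Z \<union> Z')", OF S openin_omitting mono_omitting cov] by blast
  obtain a b where ab: "a \<in> Z" "b \<in> Z'" "\<forall>n. {n..<f n} \<subseteq> a \<or> {n..<f n} \<subseteq> b"
    using intervals[of f] by (elim bexE)
  obtain n where "{ternary a, ternary b} \<subseteq> omitting (Z \<union> Z') n (f n)"
    using f[of "{ternary a, ternary b}"] ab(1,2) by auto
  then have "\<not> {n..<f n} \<subseteq> a" "\<not> {n..<f n} \<subseteq> b" by (simp_all add: omitting_iff)
  then show False using ab(3)[rule_format, of n] by blast
qed

text \<open>In the product the same pair is a single point, and squares of the sets above form
  covers whose selections miss it at every n.\<close>

lemma product_not_Menger: "\<not> Menger (prod_topology (top_of_set (ternary ` Z)) (top_of_set (ternary ` Z')))"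
proof
  let ?X = "prod_topology (top_of_set (ternary ` Z)) (top_of_set (ternary ` Z'))"
  define U where "U n m = omitting Z n m \<times> omitting Z' n m" for n m
  assume M: "Menger ?X"
  have op: "openin ?X (U n m)" for n m
    unfolding U_def openin_prod_Times_iff by (simp only: openin_omitting simp_thms)
  have mono: "mono (U n)" for n
    unfolding U_def by (intro monoI Sigma_mono monoD[OF mono_omitting])
  have cov: "topspace ?X \<subseteq> (\<Union>m. U n m)" for n
  proof
    fix p assume "p \<in> topspace ?X"
    then obtain a b where ab: "a \<in> Z" "b \<in> Z'" "p = (ternary a, ternary b)" by auto
    obtain i where i: "\<And>k. i \<le> k \<Longrightarrow> ternary a \<in> omitting Z n k"
      by (rule omitting_covers[OF ab(1) coinfinite[OF UnI1[OF ab(1)]]]) blast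
    obtain j where j: "\<And>k. j \<le> k \<Longrightarrow> ternary b \<in> omitting Z' n k"
      by (rule omitting_covers[OF ab(2) coinfinite[OF UnI2[OF ab(2)]]]) blast
    have "p \<in> U n (max i j)" using i j ab(3) by (simp add: U_def)
    then show "p \<in> (\<Union>m. U n m)" by (rule UN_I[OF UNIV_I])
  qed
  obtain f where f: "\<And>p. p \<in> topspace ?X \<Longrightarrow> \<exists>n. p \<in> U n (f n)"
    using Menger_increasing[where U = U, OF M op mono cov] by blast
  obtain a b where ab: "a \<in> Z" "b \<in> Z'" "\<forall>n. {n..<f n} \<subseteq> a \<or> {n..<f n} \<subseteq> b"
    using intervals[of f] by (elim bexE)
  obtain n where "(ternary a, ternary b) \<in> U n (f n)"
    using f[of "(ternary a, ternary b)"] ab(1,2) by auto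
  then have "\<not> {n..<f n} \<subseteq> a" "\<not> {n..<f n} \<subseteq> b" by (simp_all add: U_def omitting_iff)
  then show False using ab(3)[rule_format, of n] by blast
qed

end

text \<open>The starting point of a nonempty gap is itself outside \<open>x\<close>.\<close>

lemma coinfinite_if_gaps:
  assumes "infinite (gaps x e)" "\<And>n. n < e n"
  shows "infinite (- x)"
proof (rule infinite_super[OF _ assms(1)])
  show "gaps x e \<subseteq> - x"
  proof
    fix m assume "m \<in> gaps x e"
    moreover have "m \<in> {m..<e m}" using assms(2) by simp
    ultimately show "m \<in> - x" unfolding gaps_def by blast
  qed
qed

section \<open>The two sets of reals\<close>

lemma exists_sets_of_reals:
  assumes "\<dd> \<le>o \<rr>" "regularCard \<dd>"
  obtains X Y :: "real set" where
    "\<And>n. Menger (finite_power (top_of_set X) n)" "Scheepers (top_of_set X)"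
    "\<And>n. Menger (finite_power (top_of_set Y) n)" "Scheepers (top_of_set Y)"
    "\<not> Scheepers (top_of_set (X \<union> Y))"
    "\<not> Menger (prod_topology (top_of_set X) (top_of_set Y))"
proof -
  interpret d_le_r \<dd> by (rule d_le_r_dominating_number[OF assms])
  obtain \<rho> :: "nat set \<Rightarrow> nat \<Rightarrow> nat" where \<rho>: "\<And>b. mono (\<rho> b)" "\<And>b n. n < \<rho> b n"
    and dom: "\<And>f. \<exists>b\<in>Field \<dd>. \<forall>n. f n \<le> \<rho> b n"
    by (rule everywhere_dominating) blast
  obtain x y where inf: "\<And>c. c \<in> Field \<dd> \<Longrightarrow> infinite (x c) \<and> infinite (y c)"
    and int: "\<And>c n. c \<in> Field \<dd> \<Longrightarrow> {n..<\<rho> c n} \<subseteq> x c \<or> {n..<\<rho> c n} \<subseteq> y c"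
    and cen: "centered (gap_family \<dd> \<rho> x (Field \<dd>))" "centered (gap_family \<dd> \<rho> y (Field \<dd>))"
    by (rule two_sequences_with_gaps[where \<rho> = \<rho>, OF \<rho>]) blast
  \<comment> \<open>The finite sets are added because the product argument approximates each member
    by its finite traces, which must be points of the space.\<close>
  define Z where "Z x = {a. finite a} \<union> x ` Field \<dd>" for x :: "nat set \<Rightarrow> nat set"
  have Z: "infinite (- a)" if cen: "centered (gap_family \<dd> \<rho> x (Field \<dd>))" and a: "a \<in> Z x" for x a
  proof (cases "finite a")
    case True
    then show ?thesis by simp
  next
    case False
    then obtain c where c: "c \<in> Field \<dd>" "a = x c" using a by (auto simp: Z_def)
    have "gaps a (\<rho> c) \<in> (\<lambda>b. gaps (x c) (\<rho> b)) ` under \<dd> c"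
      using refl_r[OF c(1)] c(2) by (simp add: under_def)
    then have "gaps a (\<rho> c) \<in> gap_family \<dd> \<rho> x (Field \<dd>)"
      unfolding gap_family_def by (rule UN_I[OF c(1)])
    then have "infinite (\<Inter>{gaps a (\<rho> c)})"
      by (intro cen[unfolded centered_def, rule_format]) simp_all
    then show ?thesis using \<rho>(2) by (intro coinfinite_if_gaps[of a "\<rho> c"]) simp_all
  qed
  have pairs: "\<exists>a\<in>Z x. \<exists>b\<in>Z y. \<forall>n. {n..<f n} \<subseteq> a \<or> {n..<f n} \<subseteq> b" for f :: "nat \<Rightarrow> nat"
  proof -
    obtain c where c: "c \<in> Field \<dd>" "\<forall>n. f n \<le> \<rho> c n" using dom[of f] by (elim bexE)
    have "{n..<f n} \<subseteq> x c \<or> {n..<f n} \<subseteq> y c" for n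
    proof -
      have "{n..<f n} \<subseteq> {n..<\<rho> c n}" using c(2)[rule_format, of n] by auto
      then show ?thesis using int[OF c(1), of n] by blast
    qed
    moreover have "x c \<in> Z x" "y c \<in> Z y" using c(1) by (simp_all add: Z_def)
    ultimately show ?thesis by blast
  qed
  have co: "infinite (- a)" if "a \<in> Z x \<union> Z y" for a
    using that Z[OF cen(1)] Z[OF cen(2)] by blast
  obtain F where F: "F \<noteq> bot" "\<And>T :: (nat \<Rightarrow> real) topology. Menger_along F T \<Longrightarrow>
      Menger_along F (prod_topology T (top_of_set (ternary ` Z x)))"
    unfolding Z_def by (rule Menger_along_filter[OF dom conjunct1[OF inf] cen(1)]) blast+
  obtain G where G: "G \<noteq> bot" "\<And>T :: (nat \<Rightarrow> real) topology. Menger_along G T \<Longrightarrow>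
      Menger_along G (prod_topology T (top_of_set (ternary ` Z y)))"
    unfolding Z_def by (rule Menger_along_filter[OF dom conjunct2[OF inf] cen(2)]) blast+
  show thesis
  proof (rule that)
    show "Menger (finite_power (top_of_set (ternary ` Z x)) n)" for n
      by (rule Menger_finite_powers_and_Scheepers(1)[OF F])
    show "Scheepers (top_of_set (ternary ` Z x))"
      by (rule Menger_finite_powers_and_Scheepers(2)[OF F])
    show "Menger (finite_power (top_of_set (ternary ` Z y)) n)" for n
      by (rule Menger_finite_powers_and_Scheepers(1)[OF G])
    show "Scheepers (top_of_set (ternary ` Z y))"
      by (rule Menger_finite_powers_and_Scheepers(2)[OF G])
    show "\<not> Scheepers (top_of_set (ternary ` Z x \<union> ternary ` Z y))"
      by (rule union_not_Scheepers[OF co pairs])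
    show "\<not> Menger (prod_topology (top_of_set (ternary ` Z x)) (top_of_set (ternary ` Z y)))"
      by (rule product_not_Menger[OF co pairs])
  qed
qed

theorem theorem2p5:
  assumes d_le_r: "\<dd> \<le>o \<rr>"
    and d_regular: "regularCard \<dd>"
  shows "(\<exists>(X :: real set) (Y :: real set).
            (\<forall>n. Menger (finite_power (top_of_set X) n)) \<and>
            (\<forall>n. Menger (finite_power (top_of_set Y) n)) \<and>
            \<not> Scheepers (top_of_set (X \<union> Y))) \<and>
         (\<exists>(X :: real set) (Y :: real set).
            Scheepers (top_of_set X) \<and> Scheepers (top_of_set Y) \<and>
            \<not> Scheepers (top_of_set (X \<union> Y))) \<and>
         (\<exists>(X :: real set) (Y :: real set).
            (\<forall>n. Menger (finite_power (top_of_set X) n)) \<and>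
            (\<forall>n. Menger (finite_power (top_of_set Y) n)) \<and>
            \<not> Menger (prod_topology (top_of_set X) (top_of_set Y))) \<and>
         (\<exists>(X :: real set) (Y :: real set).
            Scheepers (top_of_set X) \<and> Scheepers (top_of_set Y) \<and>
            \<not> Scheepers (prod_topology (top_of_set X) (top_of_set Y)))"
proof -
  obtain X Y :: "real set" where X: "\<forall>n. Menger (finite_power (top_of_set X) n)" "Scheepers (top_of_set X)"
    and Y: "\<forall>n. Menger (finite_power (top_of_set Y) n)" "Scheepers (top_of_set Y)"
    and not_union: "\<not> Scheepers (top_of_set (X \<union> Y))"
    and not_prod: "\<not> Menger (prod_topology (top_of_set X) (top_of_set Y))"
    by (rule exists_sets_of_reals[OF d_le_r d_regular]) blast
  have "\<not> Scheepers (prod_topology (top_of_set X) (top_of_set Y))"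
    using not_prod Scheepers_imp_Menger by (rule contrapos_nn)
  then show ?thesis
    by (intro conjI exI[of _ X] exI[of _ Y] X Y not_union not_prod)
qed

end
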